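(* Let $\alpha,\beta,\gamma,\delta,\kappa$ be positive integers satisfying $0<\delta+\gamma\le\beta+\kappa$ and $\kappa\le\min(\alpha,\gamma)$. Then there is a $\mathbb{Z}_5\mathbb{Z}_{25}$-linear code $C$ of type $(\alpha,\beta;\gamma,\delta;\kappa)$ with $ker(C)=\gamma+2\delta-\overline{k}$ and $rank(C)=\gamma+2\delta+\overline{r}$ if and only if either $\overline{k}\in\{1,\ldots,\delta\}$ and $$\overline{r}\in\left\{1,\ldots,\min\left(\beta-(\gamma-\kappa)-\delta,\ \binom{\overline{k}+2}{3}+\binom{\overline{k}+3}{4}+\binom{\overline{k}+4}{5}-\overline{k}\right)\right\},$$ or $\overline{k}=\overline{r}=0$.
   Context: A $\mathbb{Z}_5\mathbb{Z}_{25}$-additive code is a subgroup $\mathcal{C}$ of $\mathbb{Z}_5^\alpha\times\mathbb{Z}_{25}^\beta$. The Gray map $\phi:\mathbb{Z}_{25}\to\mathbb{Z}_5^5$ is $\phi(u)=(u_1,u_1,u_1,u_1,u_1)+u_0\,Y$, where $u=u_0+5u_1$ with $u_0,u_1\in\{0,\ldots,4\}$ and $Y$ is a fixed row vector listing all distinct elements of $\mathbb{Z}_5$, e.g. $Y=(0,1,2,3,4)$. Its extension $\Phi:\mathbb{Z}_5^\alpha\times\mathbb{Z}_{25}^\beta\to\mathbb{Z}_5^{n}$, $n=\alpha+5\beta$, is $\Phi(\mathbf{x},\mathbf{y})=(\mathbf{x},\phi(y_1),\ldots,\phi(y_\beta))$. A code is called $\mathbb{Z}_5\mathbb{Z}_{25}$-linear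 if it equals $\Phi(\mathcal{C})$ for some $\mathbb{Z}_5\mathbb{Z}_{25}$-additive code $\mathcal{C}$. The additive code $\mathcal{C}$ (and $C=\Phi(\mathcal{C})$) is of type $(\alpha,\beta;\gamma,\delta;\kappa)$ if $\mathcal{C}\subseteq\mathbb{Z}_5^\alpha\times\mathbb{Z}_{25}^\beta$, $\mathcal{C}\cong\mathbb{Z}_5^\gamma\times\mathbb{Z}_{25}^\delta$ as a group, and $\kappa$ is the dimension over $\mathbb{Z}_5$ of the projection onto the first $\alpha$ (i.e. the $\mathbb{Z}_5$-) coordinates of the subcode $\{\mathbf{c}\in\mathcal{C}: 5\mathbf{c}=\mathbf{0}\}$ ($\kappa=0$ if $\alpha=0$). $\langle C\rangle$ is the $\mathbb{Z}_5$-linear span of $C$, and $rank(C)=\dim\langle C\rangle$. The kernel of $C$ is $K(C)=\{\mathbf{x}\in\mathbb{Z}_5^n \mid C+\mathbf{x}=C\}$, a $\mathbb{Z}_5$-linear space, and $ker(C)=\dim K(C)$. The notation $\{a,\ldots,b\}$ denotes the set of integers $x$ with $a\le x\le b$ (empty if $b<a$). *)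

theory Defs
  imports
    "HOL-Algebra.Product_Groups"
    "HOL-Library.Function_Algebras"
    "Berlekamp_Zassenhaus.Finite_Field"
begin

typedef five = "{..<5::nat}"
  by (rule exI[of _ 0]) simp

lemma card_five: "CARD(five) = 5"
  using type_definition.card[OF type_definition_five] by simp

instance five :: prime_card
  by standard (simp add: card_five)

type_synonym z5 = "five mod_ring"

text \<open>
  A vector of \<open>\<int>\<^sub>5\<^sup>n\<close> is a function \<open>nat \<Rightarrow> z5\<close> that vanishes at all positions \<open>\<ge> n\<close>. Since
  spans and dimensions do not depend on the surrounding space, they can be taken in the
  vector space of all functions \<open>nat \<Rightarrow> z5\<close>.
\<close>

definition scale5 :: "z5 \<Rightarrow> (nat \<Rightarrow> z5) \<Rightarrow> nat \<Rightarrow> z5"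
  where "scale5 c v = (\<lambda>i. c * v i)"

interpretation z5v: vector_space scale5
  by standard (auto simp: scale5_def fun_eq_iff algebra_simps)

definition space5 :: "nat \<Rightarrow> (nat \<Rightarrow> z5) set"
  where "space5 n = {v. \<forall>i\<ge>n. v i = 0}"

text \<open>
  The group \<open>\<int>\<^sub>5\<^sup>a \<times> \<int>\<^sub>2\<^sub>5\<^sup>b\<close>, written multiplicatively as usual in HOL-Algebra; residue classes
  are represented by the integers \<open>0, \<dots>, 4\<close> and \<open>0, \<dots>, 24\<close>.
\<close>

definition mixed_group :: "nat \<Rightarrow> nat \<Rightarrow> ((nat \<Rightarrow> int) \<times> (nat \<Rightarrow> int)) monoid"
  where "mixed_group a b =
    product_group {..<a} (\<lambda>_. integer_mod_group 5) \<times>\<times>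
    product_group {..<b} (\<lambda>_. integer_mod_group 25)"

definition additive_code :: "nat \<Rightarrow> nat \<Rightarrow> ((nat \<Rightarrow> int) \<times> (nat \<Rightarrow> int)) set \<Rightarrow> bool"
  where "additive_code \<alpha> \<beta> A \<longleftrightarrow> subgroup A (mixed_group \<alpha> \<beta>)"

definition z5_part :: "nat \<Rightarrow> (nat \<Rightarrow> int) \<times> (nat \<Rightarrow> int) \<Rightarrow> nat \<Rightarrow> z5"
  where "z5_part \<alpha> c = (\<lambda>i. if i < \<alpha> then of_int (fst c i) else 0)"

text \<open>In the multiplicative notation of HOL-Algebra, \<open>5c = 0\<close> is the fifth power being \<open>\<one>\<close>.\<close>

definition additive_code_of_type ::
    "nat \<Rightarrow> nat \<Rightarrow> nat \<Rightarrow> nat \<Rightarrow> nat \<Rightarrow> ((nat \<Rightarrow> int) \<times> (nat \<Rightarrow> int)) set \<Rightarrow> bool"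
  where "additive_code_of_type \<alpha> \<beta> \<gamma> \<delta> \<kappa> A \<longleftrightarrow>
    additive_code \<alpha> \<beta> A \<and>
    (mixed_group \<alpha> \<beta>)\<lparr>carrier := A\<rparr> \<cong> mixed_group \<gamma> \<delta> \<and>
    z5v.dim (z5_part \<alpha> ` {c \<in> A. c [^]\<^bsub>mixed_group \<alpha> \<beta>\<^esub> (5::nat) = \<one>\<^bsub>mixed_group \<alpha> \<beta>\<^esub>}) = \<kappa>"

text \<open>
  Here \<open>u = u\<^sub>0 + 5 u\<^sub>1\<close> with \<open>u\<^sub>0 = u mod 5\<close> and \<open>u\<^sub>1 = u div 5\<close>, and \<open>Y\<close> is the row vector
  \<open>(Y 0, \<dots>, Y 4)\<close>; the result is the \<open>j\<close>-th coordinate, \<open>j < 5\<close>.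
\<close>

definition gray :: "(nat \<Rightarrow> z5) \<Rightarrow> int \<Rightarrow> nat \<Rightarrow> z5"
  where "gray Y u j = of_int (u div 5) + of_int (u mod 5) * Y j"

definition Gray :: "(nat \<Rightarrow> z5) \<Rightarrow> nat \<Rightarrow> nat \<Rightarrow> (nat \<Rightarrow> int) \<times> (nat \<Rightarrow> int) \<Rightarrow> nat \<Rightarrow> z5"
  where "Gray Y \<alpha> \<beta> c = (\<lambda>i.
    if i < \<alpha> then of_int (fst c i)
    else if i < \<alpha> + 5 * \<beta> then gray Y (snd c ((i - \<alpha>) div 5)) ((i - \<alpha>) mod 5)
    else 0)"

definition linear_code_of_type ::
    "(nat \<Rightarrow> z5) \<Rightarrow> nat \<Rightarrow> nat \<Rightarrow> nat \<Rightarrow> nat \<Rightarrow> nat \<Rightarrow> (nat \<Rightarrow> z5) set \<Rightarrow> bool"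
  where "linear_code_of_type Y \<alpha> \<beta> \<gamma> \<delta> \<kappa> C \<longleftrightarrow>
    (\<exists>A. additive_code_of_type \<alpha> \<beta> \<gamma> \<delta> \<kappa> A \<and> C = Gray Y \<alpha> \<beta> ` A)"

definition code_rank :: "(nat \<Rightarrow> z5) set \<Rightarrow> nat"
  where "code_rank C = z5v.dim (z5v.span C)"

definition code_kernel :: "nat \<Rightarrow> (nat \<Rightarrow> z5) set \<Rightarrow> (nat \<Rightarrow> z5) set"
  where "code_kernel n C = {x \<in> space5 n. (\<lambda>c. c + x) ` C = C}"

definition code_ker :: "nat \<Rightarrow> (nat \<Rightarrow> z5) set \<Rightarrow> nat"
  where "code_ker n C = z5v.dim (code_kernel n C)"

end

theory Submission
  imports Defs "HOL-Computational_Algebra.Polynomial"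
begin

text \<open>
  Splitting the \<open>\<int>\<^sub>2\<^sub>5\<close>-coordinates of a codeword into low and high base-5 digits makes the Gray map
  linear and the group law linear up to a carry \<open>c(l, l')\<close> in the high digits. Let \<open>L\<close> be the space
  of low digits, \<open>P\<close> the space of high digits \<open>h\<close> with \<open>(0, 5h)\<close> in the code, and
  \<open>M = {m \<in> L. c(m, L) \<subseteq> P}\<close>. Counting fibres gives \<open>ker = \<gamma> + \<delta> + dim M\<close> and
  \<open>rank = \<gamma> + 2\<delta> + dim (P + span c(L, L)) - dim P\<close>, where \<open>dim L = \<delta>\<close> and
  \<open>dim P = \<gamma> + \<delta> - \<kappa>\<close>. So \<open>kbar\<close> is the codimension of \<open>M\<close> in \<open>L\<close>. By the cocycle identity
  carries modulo \<open>P\<close> only depend on classes modulo \<open>M\<close>, and the carry is a polynomial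
  with homogeneous parts of degrees 3, 4 and 5, so \<open>rbar\<close> is bounded by the number of monomials of
  these degrees in \<open>kbar\<close> variables, without the fifth powers \<open>x\<^sup>5 = x \<in> L \<subseteq> P\<close>.

  Conversely, separating scalings and polarizing shows that the carries of linear forms together with
  the linear forms span all of these monomials. Hence for every admissible \<open>rbar\<close> there are that many
  points at which, together with the unit vectors, this function space interpolates arbitrary values.
  Using them as columns of a generator matrix yields rank excess \<open>rbar\<close>; taking \<open>(2, \<dots>, 2)\<close> as one
  of them makes \<open>M\<close> as small as required, because a carry digit in \<open>{0, 1}\<close> equals twice another one
  only if both vanish.
\<close>

section \<open>Arithmetic of carries modulo 5\<close>

lemma z5_of_int_eq_iff: "(of_int a :: z5) = of_int b \<longleftrightarrow> a mod 5 = b mod 5"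
  unfolding of_int_of_int_mod_ring by transfer (simp add: card_five)

lemma z5_of_int_eq_0_iff: "(of_int a :: z5) = 0 \<longleftrightarrow> a mod 5 = 0"
  using z5_of_int_eq_iff[of a 0] by simp

lemma z5_of_int_mod [simp]: "(of_int (a mod 5) :: z5) = of_int a"
  by (simp add: z5_of_int_eq_iff)

lemma z5_to_int_of_int: "to_int_mod_ring (of_int a :: z5) = a mod 5"
  unfolding of_int_of_int_mod_ring by transfer (simp add: card_five)

lemma z5_to_int_range: "to_int_mod_ring (x :: z5) \<in> {0..<5}"
  using range_to_int_mod_ring[where 'a = five] by (auto simp: card_five)

lemma z5_of_int_to_int [simp]: "of_int (to_int_mod_ring (x :: z5)) = x"
  by (simp add: of_int_of_int_mod_ring)

lemma card_z5: "card (UNIV :: z5 set) = 5"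
  by (simp add: card_five)

lemma z5_cases:
  obtains a :: int where "(x :: z5) = of_int a" "a \<in> {0, 1, 2, 3, 4}"
proof -
  have "to_int_mod_ring x \<in> {0, 1, 2, 3, 4}"
    using z5_to_int_range[of x] unfolding atLeastLessThan_iff insert_iff by linarith
  then show thesis
    by (intro that[of "to_int_mod_ring x"]) auto
qed

lemma z5_pow_5: "(x :: z5) ^ 5 = x"
proof -
  obtain a where a: "x = of_int a" "a \<in> {0, 1, 2, 3, 4}"
    by (rule z5_cases)
  have "(of_int (a ^ 5) :: z5) = of_int a"
    unfolding z5_of_int_eq_iff using a(2) by auto
  then show ?thesis by (simp add: a(1))
qed

definition carry :: "z5 \<Rightarrow> z5 \<Rightarrow> z5"
  where "carry x y = of_int ((to_int_mod_ring x + to_int_mod_ring y) div 5)"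

lemma carry_of_int: "carry (of_int a) (of_int b) = of_int ((a mod 5 + b mod 5) div 5)"
  by (simp add: carry_def z5_to_int_of_int)

lemma carry_0 [simp]: "carry 0 x = 0" "carry x 0 = 0"
proof -
  obtain a where a: "x = of_int a" "a \<in> {0, 1, 2, 3, 4}"
    by (rule z5_cases)
  show "carry 0 x = 0" "carry x 0 = 0"
    using a carry_of_int[of 0 a] carry_of_int[of a 0] by auto
qed

lemma carry_commute: "carry x y = carry y x"
  by (simp add: carry_def add.commute)

text \<open>Both sides are the total carry out of the lowest digit when three digits are added,
  accumulated in two different orders.\<close>

lemma carry_cocycle: "carry x y + carry (x + y) z = carry y z + carry x (y + z)"
proof -
  obtain a where a: "x = of_int a" "a \<in> {0, 1, 2, 3, 4}"
    by (rule z5_cases)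
  obtain b where b: "y = of_int b" "b \<in> {0, 1, 2, 3, 4}"
    by (rule z5_cases)
  obtain c where c: "z = of_int c" "c \<in> {0, 1, 2, 3, 4}"
    by (rule z5_cases)
  have eq: "(a mod 5 + b mod 5) div 5 + ((a + b) mod 5 + c mod 5) div 5 =
    (b mod 5 + c mod 5) div 5 + (a mod 5 + (b + c) mod 5) div 5"
    using a(2) b(2) c(2) by auto
  have "carry x y + carry (x + y) z =
      of_int ((a mod 5 + b mod 5) div 5 + ((a + b) mod 5 + c mod 5) div 5)"
    unfolding a(1) b(1) c(1) of_int_add[symmetric] carry_of_int ..
  also have "\<dots> = carry y z + carry x (y + z)"
    unfolding eq a(1) b(1) c(1) of_int_add[symmetric] carry_of_int ..
  finally show ?thesis .
qed

text \<open>The reduced polynomial of the carry, verified on all 25 pairs of digits. Later arguments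
  use that its homogeneous parts have degrees 3, 4 and 5 and that both variables occur in every
  monomial.\<close>

lemma carry_eq_polynomial:
  "carry x y = 4*x^2*y + 4*x*y^2 + 3*x^3*y + 2*x^2*y^2 + 3*x*y^3
     + 4*x^4*y + 3*x^3*y^2 + 3*x^2*y^3 + 4*x*y^4"
proof -
  obtain a where a: "x = of_int a" "a \<in> {0, 1, 2, 3, 4}"
    by (rule z5_cases)
  obtain b where b: "y = of_int b" "b \<in> {0, 1, 2, 3, 4}"
    by (rule z5_cases)
  have "(of_int ((a mod 5 + b mod 5) div 5) :: z5) =
     of_int (4*a^2*b + 4*a*b^2 + 3*a^3*b + 2*a^2*b^2 + 3*a*b^3
     + 4*a^4*b + 3*a^3*b^2 + 3*a^2*b^3 + 4*a*b^4)"
    unfolding z5_of_int_eq_iff using a(2) b(2) by auto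
  then show ?thesis
    by (simp add: a(1) b(1) carry_of_int)
qed

lemma carry_in: "carry x y \<in> {0, 1}"
proof -
  obtain a where a: "x = of_int a" "a \<in> {0, 1, 2, 3, 4}"
    by (rule z5_cases)
  obtain b where b: "y = of_int b" "b \<in> {0, 1, 2, 3, 4}"
    by (rule z5_cases)
  show ?thesis
    using a(2) b(2) unfolding a(1) b(1) carry_of_int by auto
qed

lemma carry_eq_double_carry_imp_0:
  assumes "carry x y = 2 * carry u v"
  shows "carry u v = 0"
proof -
  have "(of_int 2 :: z5) \<noteq> of_int 0" "(of_int 2 :: z5) \<noteq> of_int 1"
    by (simp_all only: z5_of_int_eq_iff) simp_all
  then show ?thesis
    using assms carry_in[of x y] carry_in[of u v] by auto
qed

lemma carry_all_0_imp_0: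
  assumes "\<And>y. carry x y = 0"
  shows "x = 0"
proof -
  obtain a where a: "x = of_int a" "a \<in> {0, 1, 2, 3, 4}"
    by (rule z5_cases)
  \<comment> \<open>The digit 4 produces a carry with every nonzero digit, so it alone detects
    \<open>x\<close>.\<close>
  then show ?thesis
    using assms[of "of_int 4"] unfolding a(1) carry_of_int z5_of_int_eq_0_iff by auto
qed

text \<open>Reduction modulo 25 changes the high digit only by multiples of 5, so in
  \<int>\<open>\<^sub>5\<close> only the carry from the low digits disturbs additivity.\<close>

lemma z25_digits_add:
  fixes a b :: int
  shows "(of_int ((a + b) mod 25 div 5) :: z5) =
    of_int (a div 5) + of_int (b div 5) + carry (of_int a) (of_int b)"
proof -
  have "((a + b) mod 25 div 5) mod 5 =
    (a div 5 + b div 5 + (a mod 5 + b mod 5) div 5) mod 5"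
  proof -
    have "(a + b) mod 25 div 5 = (a + b) div 5 mod 5"
      using zmod_zmult2_eq[of 5 "a + b" 5] by simp
    then show ?thesis
      by (simp only: div_add1_eq[of a b 5] mod_mod_trivial)
  qed
  then show ?thesis
    unfolding carry_of_int of_int_add[symmetric] z5_of_int_eq_iff .
qed

definition vcarry :: "('a \<Rightarrow> z5) \<Rightarrow> ('a \<Rightarrow> z5) \<Rightarrow> 'a \<Rightarrow> z5"
  where "vcarry x y = (\<lambda>i. carry (x i) (y i))"

lemma vcarry_0 [simp]: "vcarry 0 x = 0" "vcarry x 0 = 0"
  by (simp_all add: vcarry_def fun_eq_iff)

lemma vcarry_commute: "vcarry x y = vcarry y x"
  by (simp add: vcarry_def carry_commute)

lemma vcarry_cocycle: "vcarry x y + vcarry (x + y) z = vcarry y z + vcarry x (y + z)"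
  by (simp add: vcarry_def fun_eq_iff carry_cocycle)

section \<open>Finite subspaces over the five-element field, with dimensions obtained by
  counting\<close>

lemma subspace_if_add_closed:
  assumes "0 \<in> S" "\<And>x y. x \<in> S \<Longrightarrow> y \<in> S \<Longrightarrow> x + y \<in> S"
  shows "z5v.subspace S"
proof (rule z5v.subspaceI)
  fix c :: z5 and x assume x: "x \<in> S"
  obtain a where a: "c = of_int a" "a \<in> {0, 1, 2, 3, 4}"
    by (rule z5_cases)
  have "scale5 (of_nat n) x \<in> S" for n
  proof (induction n)
    case 0
    then show ?case using assms(1) by (simp add: scale5_def zero_fun_def)
  next
    case (Suc n)
    have "scale5 (of_nat (Suc n)) x = x + scale5 (of_nat n) x"
      by (simp add: scale5_def fun_eq_iff algebra_simps)
    then show ?case using assms(2)[OF x Suc] by (simp only:)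
  qed
  from this[of "nat a"] show "scale5 c x \<in> S"
    using a by auto
qed (use assms in auto)

lemma finite_span_card:
  assumes "finite B" "z5v.independent B"
  shows "finite (z5v.span B) \<and> card (z5v.span B) = 5 ^ card B"
  using assms
proof (induction B)
  case empty
  then show ?case by simp
next
  case (insert b B)
  then have B: "z5v.independent B" "b \<notin> z5v.span B"
    by (auto simp: z5v.independent_insert)
  let ?f = "\<lambda>(c, v). scale5 c b + v"
  have img: "z5v.span (insert b B) = ?f ` (UNIV \<times> z5v.span B)"
  proof (rule subset_antisym; rule subsetI)
    fix v assume "v \<in> z5v.span (insert b B)"
    then obtain c where "v - scale5 c b \<in> z5v.span B"
      by (auto simp: z5v.span_insert)
    then show "v \<in> ?f ` (UNIV \<times> z5v.span B)"
      by (intro image_eqI[of _ _ "(c, v - scale5 c b)"]) auto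
  next
    fix v assume "v \<in> ?f ` (UNIV \<times> z5v.span B)"
    then obtain c u where "v = scale5 c b + u" "u \<in> z5v.span B"
      by auto
    then have "v - scale5 c b \<in> z5v.span B"
      by simp
    then show "v \<in> z5v.span (insert b B)"
      unfolding z5v.span_insert by auto
  qed
  have inj: "inj_on ?f (UNIV \<times> z5v.span B)"
  proof (rule inj_onI)
    fix p q assume p: "p \<in> UNIV \<times> z5v.span B" and q: "q \<in> UNIV \<times> z5v.span B" and eq: "?f p = ?f q"
    obtain c v d w where pq: "p = (c, v)" "q = (d, w)"
      by fastforce
    have "scale5 (c - d) b = w - v"
      using eq unfolding pq by (simp add: z5v.scale_left_diff_distrib algebra_simps)
    then have "scale5 (c - d) b \<in> z5v.span B"
      using p q pq by (simp add: z5v.span_diff)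
    then have "c = d"
      using B(2) z5v.span_scale[of "scale5 (c - d) b" B "inverse (c - d)"] by (cases "c = d") auto
    then show "p = q" using eq pq by simp
  qed
  have "card (z5v.span (insert b B)) = 5 * 5 ^ card B"
    unfolding img card_image[OF inj] using insert.IH B by (simp add: card_cartesian_product card_five)
  moreover have "finite (z5v.span (insert b B))"
    unfolding img using insert.IH B by simp
  ultimately show ?case using insert.hyps by simp
qed

lemma subspace_basis:
  assumes "z5v.subspace S" "finite S"
  obtains B where "B \<subseteq> S" "finite B" "z5v.independent B" "z5v.span B = S" "card B = z5v.dim S"
proof -
  obtain B where B: "B \<subseteq> S" "z5v.independent B" "S \<subseteq> z5v.span B" "card B = z5v.dim S"
    using z5v.basis_exists by blast
  then show thesis
    using that assms finite_subset z5v.span_minimal by (metis subset_antisym)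
qed

text \<open>Turns dimension arguments into counting: the formulas for kernel and rank are obtained
  by comparing exponents of 5.\<close>

lemma card_subspace:
  assumes "z5v.subspace S" "finite S"
  shows "card S = 5 ^ z5v.dim S"
proof -
  obtain B where "finite B" "z5v.independent B" "z5v.span B = S" "card B = z5v.dim S"
    using subspace_basis[OF assms] by metis
  then show ?thesis using finite_span_card by metis
qed

lemma dim_eqI:
  assumes "z5v.subspace S" "finite S" "card S = 5 ^ n"
  shows "z5v.dim S = n"
  using card_subspace[OF assms(1,2)] assms(3) by simp

lemma subspace_eqI:
  assumes "z5v.subspace S" "z5v.subspace T" "finite T" "S \<subseteq> T" "z5v.dim S = z5v.dim T"
  shows "S = T"
  using assms card_subspace[of S] card_subspace[of T] finite_subset by (metis card_subset_eq)

lemma dim_mono_finite: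
  assumes "z5v.subspace S" "z5v.subspace T" "finite T" "S \<subseteq> T"
  shows "z5v.dim S \<le> z5v.dim T"
  using assms card_subspace[of S] card_subspace[of T] card_mono[of T S] finite_subset[of S T]
  by simp

lemma subspace_space5: "z5v.subspace (space5 n)"
  by (rule subspace_if_add_closed) (auto simp: space5_def)

lemma finite_card_space5: "finite (space5 n) \<and> card (space5 n) = 5 ^ n"
proof -
  have bij: "bij_betw (\<lambda>v. restrict v {..<n}) (space5 n) (PiE {..<n} (\<lambda>_. UNIV :: z5 set))"
    by (rule bij_betw_byWitness[where f' = "\<lambda>v i. if i < n then v i else 0"])
      (auto simp: space5_def restrict_def PiE_def extensional_def)
  have "finite (PiE {..<n} (\<lambda>_. UNIV :: z5 set))"
    by (intro finite_PiE) auto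
  moreover have "card (PiE {..<n} (\<lambda>_. UNIV :: z5 set)) = 5 ^ n"
    by (simp add: card_PiE card_five)
  ultimately show ?thesis
    using bij_betw_finite[OF bij] bij_betw_same_card[OF bij] by simp
qed

lemma dim_space5 [simp]: "z5v.dim (space5 n) = n"
  by (rule dim_eqI) (use subspace_space5 finite_card_space5 in auto)

text \<open>Equal fibres take the place of rank-nullity here, because the digit set of a code is in
  general not a vector space.\<close>

lemma card_eq_card_image_mult:
  assumes "finite S" "\<And>s. s \<in> S \<Longrightarrow> card {t \<in> S. f t = f s} = n"
  shows "card S = card (f ` S) * n"
proof -
  have "card S = (\<Sum>y\<in>f ` S. card {t \<in> S. f t = y})"
    using sum.image_gen[OF assms(1), of "\<lambda>_. 1::nat" f] by simp
  also have "\<dots> = (\<Sum>y\<in>f ` S. n)"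
    by (rule sum.cong) (use assms(2) in auto)
  finally show ?thesis by simp
qed

section \<open>Carries as combinations of monomials\<close>

lemma power_fun_apply [simp]: "(f ^ n) x = (f x :: 'b :: comm_semiring_1) ^ n"
  by (induction n) auto

lemma sum_fun_apply: "sum f A x = (\<Sum>i\<in>A. f i x :: 'b :: comm_monoid_add)"
  by (induction A rule: infinite_finite_induct) auto

lemma prod_fun_apply: "prod f A x = (\<Prod>i\<in>A. f i x :: 'b :: comm_monoid_mult)"
  by (induction A rule: infinite_finite_induct) auto

lemma scale5_mult_left: "scale5 c x * y = scale5 c (x * y)"
  by (simp add: scale5_def fun_eq_iff algebra_simps)

lemma scale5_mult_right: "x * scale5 c y = scale5 c (x * y)"
  by (simp add: scale5_def fun_eq_iff algebra_simps)

text \<open>Exponent vectors are lists; the product is the pointwise one of functions.\<close>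

definition mon :: "(nat \<Rightarrow> nat \<Rightarrow> z5) \<Rightarrow> nat list \<Rightarrow> nat \<Rightarrow> z5"
  where "mon b e = (\<Prod>i<length e. b i ^ (e ! i))"

definition exponents :: "nat \<Rightarrow> nat \<Rightarrow> nat list set"
  where "exponents k d = {e. length e = k \<and> sum_list e = d}"

lemma finite_exponents: "finite (exponents k d)"
proof (rule finite_subset)
  show "exponents k d \<subseteq> {e. set e \<subseteq> {..d} \<and> length e = k}"
    by (auto simp: exponents_def intro: member_le_sum_list)
qed (simp add: finite_lists_length_eq)

lemma card_exponents: "card (exponents k d) = (d + k - 1) choose d"
  unfolding exponents_def by (rule card_length_sum_list)

lemma mult_mon:
  assumes "i < length e"
  shows "b i * mon b e = mon b (e[i := Suc (e ! i)])"
proof -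
  have "mon b (e[i := Suc (e ! i)]) = (\<Prod>j<length e. (if j = i then b i else 1) * b j ^ (e ! j))"
    unfolding mon_def length_list_update
    by (rule prod.cong) (use assms in \<open>auto simp: nth_list_update\<close>)
  also have "\<dots> = b i * mon b e"
    using assms by (simp add: prod.distrib mon_def prod.delta)
  finally show ?thesis ..
qed

lemma sum_list_Suc_nth:
  fixes e :: "nat list"
  assumes "i < length e"
  shows "sum_list (e[i := Suc (e ! i)]) = Suc (sum_list e)"
  using assms elem_le_sum_list[OF assms] by (simp add: sum_list_update)

definition forms :: "(nat \<Rightarrow> nat \<Rightarrow> z5) \<Rightarrow> nat \<Rightarrow> nat \<Rightarrow> (nat \<Rightarrow> z5) set"
  where "forms b k d = z5v.span (mon b ` exponents k d)"

lemma mult_form: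
  assumes "x \<in> z5v.span (b ` {..<k})" "u \<in> forms b k d"
  shows "x * u \<in> forms b k (Suc d)"
  using assms(1)
proof (induction rule: z5v.span_induct_alt)
  case base
  then show ?case by (simp only: mult_zero_left forms_def z5v.span_zero)
next
  case (step c v w)
  then obtain i where i: "i < k" "v = b i" by auto
  have "b i * u \<in> forms b k (Suc d)"
    using assms(2) unfolding forms_def
  proof (induction rule: z5v.span_induct_alt)
    case base
    then show ?case by (simp only: mult_zero_right z5v.span_zero)
  next
    case (step c' v' w')
    then obtain e where e: "e \<in> exponents k d" "v' = mon b e" by auto
    have "e[i := Suc (e ! i)] \<in> exponents k (Suc d)"
      using e(1) i(1) by (simp add: exponents_def sum_list_Suc_nth)
    then have "b i * v' \<in> z5v.span (mon b ` exponents k (Suc d))"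
      unfolding e(2) using e(1) i(1) by (subst mult_mon) (auto simp: exponents_def intro: z5v.span_base)
    then show ?case
      unfolding distrib_left scale5_mult_right
      by (intro z5v.span_add z5v.span_scale step.IH)
  qed
  then show ?case
    using step.IH unfolding i(2) forms_def distrib_right scale5_mult_left
    by (intro z5v.span_add z5v.span_scale)
qed

text \<open>Multiplying by one linear form at a time raises the degree by one, so expanding the
  powers stays within homogeneous combinations.\<close>

lemma power_mult_power_form:
  assumes "x \<in> z5v.span (b ` {..<k})" "y \<in> z5v.span (b ` {..<k})"
  shows "x ^ p * y ^ q \<in> forms b k (p + q)"
proof (induction p)
  case 0
  show ?case
  proof (induction q)
    case 0
    have "replicate k 0 \<in> exponents k 0"
      by (simp add: exponents_def)
    then have "mon b (replicate k 0) \<in> forms b k 0"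
      unfolding forms_def by (intro z5v.span_base imageI)
    moreover have "mon b (replicate k 0) = x ^ 0 * y ^ 0"
      by (simp add: mon_def fun_eq_iff)
    ultimately show ?case by (simp only: add_0)
  next
    case (Suc q)
    then show ?case using mult_form[OF assms(2), of "y ^ q" q]
      by (simp only: power_0 mult_1 add_0 power_Suc)
  qed
next
  case (Suc p)
  then show ?case using mult_form[OF assms(1), of "x ^ p * y ^ q" "p + q"]
    by (simp only: mult.assoc power_Suc add_Suc)
qed

lemma vcarry_eq_polynomial:
  "vcarry x y = scale5 4 (x^2*y^1) + scale5 4 (x^1*y^2) + scale5 3 (x^3*y^1) + scale5 2 (x^2*y^2)
     + scale5 3 (x^1*y^3) + scale5 4 (x^4*y^1) + scale5 3 (x^3*y^2) + scale5 3 (x^2*y^3)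
     + scale5 4 (x^1*y^4)"
  by (simp add: vcarry_def scale5_def fun_eq_iff carry_eq_polynomial mult.assoc)

lemma vcarry_in_forms:
  assumes "x \<in> z5v.span (b ` {..<k})" "y \<in> z5v.span (b ` {..<k})"
    and "z5v.subspace F" "\<And>d. d \<in> {3, 4, 5} \<Longrightarrow> forms b k d \<subseteq> F"
  shows "vcarry x y \<in> F"
proof -
  have F: "x ^ p * y ^ q \<in> F" if "p + q \<in> {3, 4, 5}" for p q
    using power_mult_power_form[OF assms(1,2), of p q] assms(4)[OF that] by auto
  show ?thesis
    unfolding vcarry_eq_polynomial
    by (intro z5v.subspace_add[OF assms(3)] z5v.subspace_scale[OF assms(3)] F) simp_all
qed

text \<open>As functions on \<open>\<int>\<^sub>5\<^sup>k\<close> the powers \<open>b\<^sub>i\<^sup>5 = b\<^sub>i\<close> are linear, so they are left out of the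
  monomials of degree \<open>5\<close>.\<close>

definition nonlin :: "nat \<Rightarrow> nat list set"
  where "nonlin k = exponents k 3 \<union> exponents k 4 \<union> {e \<in> exponents k 5. 5 \<notin> set e}"

lemma finite_nonlin: "finite (nonlin k)"
  by (simp add: nonlin_def finite_exponents)

lemma sum_list_eq_nth:
  fixes e :: "nat list"
  assumes "i < length e" "e ! i = sum_list e"
  shows "e = (replicate (length e) 0)[i := sum_list e]"
proof (rule nth_equalityI)
  fix j assume j: "j < length e"
  have "e ! j = 0" if "j \<noteq> i"
  proof -
    have "sum_list e = (\<Sum>l<length e. e ! l)"
      by (simp add: sum_list_sum_nth atLeast0LessThan)
    also have "\<dots> = e ! i + (\<Sum>l\<in>{..<length e} - {i}. e ! l)"
      using assms(1) by (simp add: sum.remove)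
    finally have "(\<Sum>l\<in>{..<length e} - {i}. e ! l) = 0"
      using assms(2) by simp
    then show ?thesis using that j by simp
  qed
  then show "e ! j = (replicate (length e) 0)[i := sum_list e] ! j"
    using assms j by (auto simp: nth_list_update)
qed simp

text \<open>An entry 5 uses up the whole degree, which leaves exactly one exponent vector per
  variable: its fifth power.\<close>

lemma exponents_with_5:
  "{e \<in> exponents k 5. 5 \<in> set e} = (\<lambda>i. (replicate k 0)[i := 5]) ` {..<k}"
proof (rule subset_antisym; rule subsetI)
  fix e assume "e \<in> {e \<in> exponents k 5. 5 \<in> set e}"
  then obtain i where "i < k" "e ! i = 5" "length e = k" "sum_list e = 5"
    by (auto simp: exponents_def in_set_conv_nth)
  then show "e \<in> (\<lambda>i. (replicate k 0)[i := 5]) ` {..<k}"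
    using sum_list_eq_nth[of i e] by auto
next
  fix e assume "e \<in> (\<lambda>i. (replicate k (0::nat))[i := 5]) ` {..<k}"
  then show "e \<in> {e \<in> exponents k 5. 5 \<in> set e}"
    by (auto simp: exponents_def sum_list_update set_update_memI)
qed

text \<open>Stars and bars in each of the three degrees; the summand \<open>k\<close> on the left
  restores the omitted fifth powers. This is the source of the binomial bound.\<close>

lemma card_nonlin:
  "card (nonlin k) + k = ((k + 2) choose 3) + ((k + 3) choose 4) + ((k + 4) choose 5)"
proof -
  have "inj_on (\<lambda>i. (replicate k (0::nat))[i := 5]) {..<k}"
  proof (rule inj_onI)
    fix i j assume "i \<in> {..<k}" "j \<in> {..<k}" "(replicate k (0::nat))[i := 5] = (replicate k 0)[j := 5]"
    then show "i = j"
      by (metis length_list_update length_replicate lessThan_iff nth_list_update nth_replicate zero_neq_numeral)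
  qed
  then have "card {e \<in> exponents k 5. 5 \<in> set e} = k"
    by (simp add: exponents_with_5 card_image)
  moreover have "card (exponents k 5) =
      card {e \<in> exponents k 5. 5 \<notin> set e} + card {e \<in> exponents k 5. 5 \<in> set e}"
    by (subst card_Un_disjoint[symmetric]) (auto simp: finite_exponents intro: arg_cong[where f = card])
  moreover have "card (nonlin k) =
      card (exponents k 3) + card (exponents k 4) + card {e \<in> exponents k 5. 5 \<notin> set e}"
  proof -
    have "(exponents k 3 \<union> exponents k 4) \<inter> {e \<in> exponents k 5. 5 \<notin> set e} = {}"
      "exponents k 3 \<inter> exponents k 4 = {}"
      by (auto simp: exponents_def)
    then show ?thesis
      by (simp add: nonlin_def card_Un_disjoint finite_exponents)
  qed
  ultimately show ?thesis
    by (simp add: card_exponents add.commute)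
qed

lemma mon_replicate_update: "i < k \<Longrightarrow> mon b ((replicate k 0)[i := d]) = b i ^ d"
proof -
  assume "i < k"
  have "mon b ((replicate k 0)[i := d]) = (\<Prod>j<k. if j = i then b i ^ d else 1)"
    unfolding mon_def by (rule prod.cong) (auto simp: nth_list_update)
  then show ?thesis using \<open>i < k\<close> by (simp add: prod.delta)
qed

lemma vfun_pow_5: "(x :: 'a \<Rightarrow> z5) ^ 5 = x"
  by (simp add: fun_eq_iff z5_pow_5)

lemma vcarry_in_span_nonlin:
  assumes "x \<in> z5v.span (b ` {..<k})" "y \<in> z5v.span (b ` {..<k})"
  shows "vcarry x y \<in> z5v.span (mon b ` nonlin k \<union> b ` {..<k})"
proof (rule vcarry_in_forms[OF assms])
  fix d :: nat assume d: "d \<in> {3, 4, 5}"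
  have "mon b e \<in> z5v.span (mon b ` nonlin k \<union> b ` {..<k})" if e: "e \<in> exponents k d" for e
  proof (cases "e \<in> nonlin k")
    case True
    then show ?thesis by (intro z5v.span_base) auto
  next
    case False
    \<comment> \<open>Degrees 3 and 4 are contained in \<open>nonlin k\<close> entirely, so a
      missing exponent vector belongs to a fifth power, which is the linear form itself.\<close>
    then have "e \<in> {e \<in> exponents k 5. 5 \<in> set e}"
      using d e by (auto simp: nonlin_def)
    then obtain i where "i < k" "e = (replicate k 0)[i := 5]"
      unfolding exponents_with_5 by auto
    then have "mon b e \<in> b ` {..<k}"
      by (simp add: mon_replicate_update vfun_pow_5)
    then show ?thesis by (intro z5v.span_base) auto
  qed
  then show "forms b k d \<subseteq> z5v.span (mon b ` nonlin k \<union> b ` {..<k})"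
    unfolding forms_def by (intro z5v.span_minimal) auto
qed simp

section \<open>Kernel and rank of a code with carries\<close>

text \<open>The Gray map in digit coordinates, see \<open>Gray_eq_gamma\<close>. In this form it is
  additive in \<open>(x, l, h)\<close>, so all nonlinearity of a code sits in the carries.\<close>

definition gamma :: "(nat \<Rightarrow> z5) \<Rightarrow> nat \<Rightarrow> nat \<Rightarrow> (nat \<Rightarrow> z5) \<Rightarrow> (nat \<Rightarrow> z5) \<Rightarrow> (nat \<Rightarrow> z5) \<Rightarrow> nat \<Rightarrow> z5"
  where "gamma Y \<alpha> \<beta> x l h = (\<lambda>i.
    if i < \<alpha> then x i
    else if i < \<alpha> + 5 * \<beta> then h ((i - \<alpha>) div 5) + l ((i - \<alpha>) div 5) * Y ((i - \<alpha>) mod 5)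
    else 0)"

lemma gamma_add:
  "gamma Y \<alpha> \<beta> x l h + gamma Y \<alpha> \<beta> x' l' h' = gamma Y \<alpha> \<beta> (x + x') (l + l') (h + h')"
  by (simp add: gamma_def fun_eq_iff algebra_simps)

lemma gamma_0: "gamma Y \<alpha> \<beta> 0 0 0 = 0"
  by (simp add: gamma_def fun_eq_iff)

lemma gamma_in_space5: "gamma Y \<alpha> \<beta> x l h \<in> space5 (\<alpha> + 5 * \<beta>)"
  by (simp add: gamma_def space5_def)

text \<open>Positions 0 and 1 of each block of five give two linear equations for the pair of
  digits; since \<open>Y 0\<close> and \<open>Y 1\<close> differ, they determine first the low digit
  and then the high digit.\<close>

lemma gamma_eqD:
  assumes eq: "gamma Y \<alpha> \<beta> x l h = gamma Y \<alpha> \<beta> x' l' h'" and Y: "Y 0 \<noteq> Y 1"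
    and "x \<in> space5 \<alpha>" "l \<in> space5 \<beta>" "h \<in> space5 \<beta>"
    and "x' \<in> space5 \<alpha>" "l' \<in> space5 \<beta>" "h' \<in> space5 \<beta>"
  shows "x = x' \<and> l = l' \<and> h = h'"
proof -
  have "x i = x' i" for i
  proof (cases "i < \<alpha>")
    case True
    then show ?thesis using fun_cong[OF eq, of i] by (simp add: gamma_def)
  qed (use assms in \<open>simp add: space5_def\<close>)
  moreover have "l k = l' k \<and> h k = h' k" for k
  proof (cases "k < \<beta>")
    case True
    have 0: "h k + l k * Y 0 = h' k + l' k * Y 0"
      using fun_cong[OF eq, of "\<alpha> + 5 * k"] True by (simp add: gamma_def)
    have 1: "h k + l k * Y 1 = h' k + l' k * Y 1"
      using fun_cong[OF eq, of "\<alpha> + (1 + 5 * k)"] True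
      by (simp add: gamma_def del: One_nat_def add_Suc plus_1_eq_Suc)
    have "(l k - l' k) * (Y 1 - Y 0) = (h k + l k * Y 1) - (h k + l k * Y 0)
        - ((h' k + l' k * Y 1) - (h' k + l' k * Y 0))"
      by (simp add: algebra_simps)
    then have "(l k - l' k) * (Y 1 - Y 0) = 0"
      unfolding 0 1 by simp
    then show ?thesis using Y 0 by auto
  qed (use assms in \<open>simp add: space5_def\<close>)
  ultimately show ?thesis by (simp add: fun_eq_iff)
qed

text \<open>Codewords are represented by their \<open>\<int>\<^sub>5\<close>-coordinates and by the vectors of low and high
  base-5 digits of the \<open>\<int>\<^sub>2\<^sub>5\<close>-coordinates. The group law is then linear up to a carry in the
  high digits.\<close>

locale carry_code =
  fixes Y :: "nat \<Rightarrow> z5" and \<alpha> \<beta> :: nat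
    and D :: "((nat \<Rightarrow> z5) \<times> (nat \<Rightarrow> z5) \<times> (nat \<Rightarrow> z5)) set"
  assumes Y: "Y 0 \<noteq> Y 1"
    and support: "(x, l, h) \<in> D \<Longrightarrow> x \<in> space5 \<alpha> \<and> l \<in> space5 \<beta> \<and> h \<in> space5 \<beta>"
    and zero: "(0, 0, 0) \<in> D"
    and add: "(x, l, h) \<in> D \<Longrightarrow> (x', l', h') \<in> D \<Longrightarrow> (x + x', l + l', h + h' + vcarry l l') \<in> D"
    and neg: "(x, l, h) \<in> D \<Longrightarrow> (- x, - l, - h - vcarry l (- l)) \<in> D"
begin

abbreviation "\<Gamma> \<equiv> gamma Y \<alpha> \<beta>"

text \<open>In the notation of the introduction, \<open>lows\<close> is L, \<open>highs\<close> is
  P, \<open>radical\<close> is M and \<open>envelope\<close> is P + span c(L, L). The words killed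
  by 5 are those with zero low digits; \<open>torsion\<close> keeps their two other
  components.\<close>

definition "lows = {l. \<exists>x h. (x, l, h) \<in> D}"
definition "torsion = {(x, h). (x, 0, h) \<in> D}"
definition "torsion_proj = {x. \<exists>h. (x, 0, h) \<in> D}"
definition "highs = {h. (0, 0, h) \<in> D}"
definition "radical = {m \<in> lows. \<forall>l\<in>lows. vcarry m l \<in> highs}"
definition "carries = {vcarry l m |l m. l \<in> lows \<and> m \<in> lows}"
definition "envelope = z5v.span (highs \<union> carries)"
definition "code = (\<lambda>(x, l, h). \<Gamma> x l h) ` D"

lemma finite_D: "finite D"
proof (rule finite_subset)
  show "D \<subseteq> space5 \<alpha> \<times> space5 \<beta> \<times> space5 \<beta>"
    using support by fast
qed (use finite_card_space5 in auto)

lemma diff_in_D: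
  assumes "(x, l, h) \<in> D" "(x', l, h') \<in> D"
  shows "(x - x', 0, h - h') \<in> D"
  using add[OF assms(1) neg[OF assms(2)]] by simp

lemma shift_in_D:
  assumes "(x, l, h) \<in> D" "(t, 0, u) \<in> D"
  shows "(x + t, l, h + u) \<in> D"
  using add[OF assms] by simp

lemma subspace_lows: "z5v.subspace lows"
proof (rule subspace_if_add_closed)
  show "0 \<in> lows" using zero by (auto simp: lows_def)
  show "x + y \<in> lows" if "x \<in> lows" "y \<in> lows" for x y
    using that add unfolding lows_def by blast
qed

lemma subspace_highs: "z5v.subspace highs"
proof (rule subspace_if_add_closed)
  show "0 \<in> highs" using zero by (auto simp: highs_def)
  show "x + y \<in> highs" if "x \<in> highs" "y \<in> highs" for x y
    using shift_in_D[of 0 0 x 0 y] that unfolding highs_def by simp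
qed

lemma subspace_torsion_proj: "z5v.subspace torsion_proj"
proof (rule subspace_if_add_closed)
  show "0 \<in> torsion_proj" using zero by (auto simp: torsion_proj_def)
  show "x + y \<in> torsion_proj" if "x \<in> torsion_proj" "y \<in> torsion_proj" for x y
    using shift_in_D that unfolding torsion_proj_def by blast
qed

text \<open>The cocycle identity writes c(x + y, l) through c(y, l), c(x, y + l) and c(x, y), each
  of which lies in P.\<close>

lemma subspace_radical: "z5v.subspace radical"
proof (rule subspace_if_add_closed)
  show "0 \<in> radical"
    using z5v.subspace_0[OF subspace_lows] z5v.subspace_0[OF subspace_highs]
    by (simp add: radical_def)
  show "x + y \<in> radical" if "x \<in> radical" "y \<in> radical" for x y
  proof -
    have "vcarry (x + y) l \<in> highs" if "l \<in> lows" for l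
    proof -
      have "vcarry (x + y) l = vcarry y l + vcarry x (y + l) - vcarry x y"
        using vcarry_cocycle[of x y l] by (simp add: algebra_simps)
      moreover have "y + l \<in> lows"
        using \<open>y \<in> radical\<close> \<open>l \<in> lows\<close> z5v.subspace_add[OF subspace_lows] by (simp add: radical_def)
      ultimately show ?thesis
        using \<open>x \<in> radical\<close> \<open>y \<in> radical\<close> \<open>l \<in> lows\<close>
        by (auto simp only: radical_def mem_Collect_eq
          intro!: z5v.subspace_add[OF subspace_highs] z5v.subspace_diff[OF subspace_highs])
    qed
    then show ?thesis
      using that z5v.subspace_add[OF subspace_lows] by (simp add: radical_def)
  qed
qed

lemma subspace_envelope: "z5v.subspace envelope"
  by (simp add: envelope_def)

lemma lows_subset: "lows \<subseteq> space5 \<beta>"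
  using support by (auto simp: lows_def)

lemma highs_subset: "highs \<subseteq> space5 \<beta>"
  using support by (auto simp: highs_def)

lemma vcarry_in_space5: "x \<in> space5 n \<Longrightarrow> vcarry x y \<in> space5 n"
  by (simp add: space5_def vcarry_def)

lemma envelope_subset: "envelope \<subseteq> space5 \<beta>"
  unfolding envelope_def using highs_subset lows_subset vcarry_in_space5
  by (intro z5v.span_minimal subspace_space5) (auto simp: carries_def)

lemma torsion_proj_subset: "torsion_proj \<subseteq> space5 \<alpha>"
  using support by (auto simp: torsion_proj_def)

lemma finite_subspaces: "finite lows" "finite highs" "finite envelope" "finite radical" "finite torsion_proj"
  using lows_subset highs_subset envelope_subset torsion_proj_subset finite_card_space5 finite_subset
  by (blast, blast, blast, (metis (no_types, lifting) mem_Collect_eq radical_def subsetI), blast)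

lemma highs_subset_envelope: "highs \<subseteq> envelope"
  unfolding envelope_def by (meson Un_upper1 order_trans z5v.span_superset)

lemma vcarry_in_envelope: "l \<in> lows \<Longrightarrow> m \<in> lows \<Longrightarrow> vcarry l m \<in> envelope"
  unfolding envelope_def by (rule z5v.span_base) (auto simp: carries_def)

section \<open>Sizes of the code, its kernel and its span by counting fibres\<close>

lemma card_fiber_torsion:
  assumes "(x, l, h) \<in> D"
  shows "card {d \<in> D. fst (snd d) = l} = card torsion"
proof -
  \<comment> \<open>Adding a word with zero low digits causes no carry, so the words with low digits
    \<open>l\<close> form a translate of \<open>torsion\<close>.\<close>
  have "bij_betw (\<lambda>(t, u). (x + t, l, h + u)) torsion {d \<in> D. fst (snd d) = l}"
  proof (rule bij_betw_imageI)
    show "inj_on (\<lambda>(t, u). (x + t, l, h + u)) torsion"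
      by (auto simp: inj_on_def)
    show "(\<lambda>(t, u). (x + t, l, h + u)) ` torsion = {d \<in> D. fst (snd d) = l}"
    proof (rule subset_antisym; rule subsetI)
      fix d assume "d \<in> (\<lambda>(t, u). (x + t, l, h + u)) ` torsion"
      then show "d \<in> {d \<in> D. fst (snd d) = l}"
        using shift_in_D[OF assms] by (auto simp: torsion_def)
    next
      fix d assume d: "d \<in> {d \<in> D. fst (snd d) = l}"
      then obtain x' h' where d': "d = (x', l, h')" "(x', l, h') \<in> D"
        by (cases d) auto
      show "d \<in> (\<lambda>(t, u). (x + t, l, h + u)) ` torsion"
        using diff_in_D[OF d'(2) assms] unfolding d'(1) torsion_def
        by (intro image_eqI[of _ _ "(x' - x, h' - h)"]) simp_all
    qed
  qed
  then show ?thesis by (simp add: bij_betw_same_card)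
qed

lemma card_D: "card D = card lows * card torsion"
proof -
  have "(\<lambda>d. fst (snd d)) ` D = lows"
    by (force simp: lows_def)
  then show ?thesis
    using card_eq_card_image_mult[OF finite_D, of "\<lambda>d. fst (snd d)" "card torsion"]
      card_fiber_torsion by fastforce
qed

lemma card_torsion: "card torsion = card torsion_proj * card highs"
proof -
  have "torsion \<subseteq> (\<lambda>d. (fst d, snd (snd d))) ` D"
    by (force simp: torsion_def)
  then have fin: "finite torsion"
    using finite_D finite_surj by blast
  have fiber: "card {t \<in> torsion. fst t = x} = card highs" if "(x, 0, h) \<in> D" for x h
  proof -
    have "bij_betw (\<lambda>p. (x, h + p)) highs {t \<in> torsion. fst t = x}"
    proof (rule bij_betw_imageI)
      show "(\<lambda>p. (x, h + p)) ` highs = {t \<in> torsion. fst t = x}"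
      proof (rule subset_antisym; rule subsetI)
        fix t assume "t \<in> (\<lambda>p. (x, h + p)) ` highs"
        then show "t \<in> {t \<in> torsion. fst t = x}"
          using shift_in_D[OF that, of 0] by (auto simp: torsion_def highs_def)
      next
        fix t assume "t \<in> {t \<in> torsion. fst t = x}"
        then obtain h' where t: "t = (x, h')" "(x, 0, h') \<in> D"
          by (cases t) (auto simp: torsion_def)
        show "t \<in> (\<lambda>p. (x, h + p)) ` highs"
          using diff_in_D[OF t(2) that] unfolding t(1) highs_def
          by (intro image_eqI[of _ _ "h' - h"]) simp_all
      qed
    qed (auto simp: inj_on_def)
    then show ?thesis by (simp add: bij_betw_same_card)
  qed
  have "fst ` torsion = torsion_proj"
    by (force simp: torsion_def torsion_proj_def)
  then show ?thesis
    using card_eq_card_image_mult[OF fin, of fst "card highs"] fiber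
    by (fastforce simp: torsion_def)
qed

lemma gamma_inj:
  "inj_on (\<lambda>(x, l, h). \<Gamma> x l h) (space5 \<alpha> \<times> space5 \<beta> \<times> space5 \<beta>)"
proof (rule inj_onI)
  fix d e assume de: "d \<in> space5 \<alpha> \<times> space5 \<beta> \<times> space5 \<beta>" "e \<in> space5 \<alpha> \<times> space5 \<beta> \<times> space5 \<beta>"
    and eq: "(\<lambda>(x, l, h). \<Gamma> x l h) d = (\<lambda>(x, l, h). \<Gamma> x l h) e"
  obtain x l h x' l' h' where "d = (x, l, h)" "e = (x', l', h')"
    by (cases d, cases e) auto
  then show "d = e"
    using de eq gamma_eqD[OF _ Y, of \<alpha> \<beta> x l h x' l' h'] by simp
qed

lemma code_iff:
  assumes "x \<in> space5 \<alpha>" "l \<in> space5 \<beta>" "h \<in> space5 \<beta>"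
  shows "\<Gamma> x l h \<in> code \<longleftrightarrow> (x, l, h) \<in> D"
proof
  assume "\<Gamma> x l h \<in> code"
  then obtain x' l' h' where d: "(x', l', h') \<in> D" "\<Gamma> x l h = \<Gamma> x' l' h'"
    by (auto simp: code_def)
  then show "(x, l, h) \<in> D"
    using gamma_eqD[OF d(2) Y assms] support[OF d(1)] by simp
qed (force simp: code_def)

text \<open>Translation adds digits without carry, whereas the code is closed under addition with
  carry. The two results differ by c(m, l) in the high digits alone, so translation by a word with
  low digits \<open>m\<close> preserves the code exactly when all these carries lie in P.\<close>

lemma code_kernel_eq:
  "code_kernel (\<alpha> + 5 * \<beta>) code = (\<lambda>(x, l, h). \<Gamma> x l h) ` {d \<in> D. fst (snd d) \<in> radical}"
proof (rule subset_antisym; rule subsetI)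
  fix v assume v: "v \<in> code_kernel (\<alpha> + 5 * \<beta>) code"
  have transl: "c + v \<in> code" if "c \<in> code" for c
    using v that by (auto simp: code_kernel_def)
  \<comment> \<open>Since 0 is a codeword, every element of the kernel is itself a codeword and has
    digits.\<close>
  have "0 \<in> code"
    unfolding code_def using zero by (rule rev_image_eqI) (simp only: prod.case gamma_0)
  then have "v \<in> code" using transl[of 0] by simp
  then obtain x m h where d: "(x, m, h) \<in> D" "v = \<Gamma> x m h"
    by (auto simp: code_def)
  have "vcarry m l \<in> highs" if l: "l \<in> lows" for l
  proof -
    obtain x' h' where d': "(x', l, h') \<in> D"
      using l by (auto simp: lows_def)
    then have "\<Gamma> x' l h' \<in> code"
      by (force simp: code_def)
    from transl[OF this] have "\<Gamma> (x + x') (m + l) (h + h') \<in> code"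
      unfolding d(2) gamma_add by (simp only: add.commute)
    moreover have "x + x' \<in> space5 \<alpha>" "m + l \<in> space5 \<beta>" "h + h' \<in> space5 \<beta>"
      using support[OF d(1)] support[OF d'] by (auto simp: space5_def)
    ultimately have "(x + x', m + l, h + h') \<in> D"
      using code_iff by blast
    from diff_in_D[OF add[OF d(1) d'] this] show ?thesis
      by (simp add: highs_def)
  qed
  moreover have "m \<in> lows" using d by (auto simp: lows_def)
  ultimately show "v \<in> (\<lambda>(x, l, h). \<Gamma> x l h) ` {d \<in> D. fst (snd d) \<in> radical}"
    using d by (intro image_eqI[of _ _ "(x, m, h)"]) (auto simp: radical_def)
next
  fix v assume "v \<in> (\<lambda>(x, l, h). \<Gamma> x l h) ` {d \<in> D. fst (snd d) \<in> radical}"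
  then obtain x m h where d: "(x, m, h) \<in> D" "m \<in> radical" and v: "v = \<Gamma> x m h"
    by auto
  have "c + v \<in> code" if c: "c \<in> code" for c
  proof -
    obtain x' l h' where d': "(x', l, h') \<in> D" "c = \<Gamma> x' l h'"
      using c by (auto simp: code_def)
    then have "vcarry m l \<in> highs"
      using d(2) by (auto simp: radical_def lows_def)
    then have "- vcarry m l \<in> highs"
      using z5v.subspace_neg[OF subspace_highs] by blast
    then have "(0, 0, - vcarry m l) \<in> D" by (simp add: highs_def)
    from shift_in_D[OF add[OF d(1) d'(1)] this] have "(x + x', m + l, h + h') \<in> D"
      by simp
    then have "\<Gamma> (x + x') (m + l) (h + h') \<in> code"
      by (force simp: code_def)
    then show ?thesis
      unfolding v d'(2) gamma_add by (simp only: add.commute)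
  qed
  \<comment> \<open>An injective map of a finite set into itself is onto, so the inclusion already
    proved suffices.\<close>
  moreover have "finite code"
    unfolding code_def using finite_D by blast
  moreover have "inj_on (\<lambda>c. c + v) code"
    by (simp add: inj_on_def)
  ultimately have "(\<lambda>c. c + v) ` code = code"
    by (intro endo_inj_surj) auto
  then show "v \<in> code_kernel (\<alpha> + 5 * \<beta>) code"
    by (simp add: code_kernel_def v gamma_in_space5)
qed

lemma inj_on_gamma_D: "A \<subseteq> D \<Longrightarrow> inj_on (\<lambda>(x, l, h). \<Gamma> x l h) A"
  using support by (intro inj_on_subset[OF gamma_inj]) fast

lemma card_code_kernel: "card (code_kernel (\<alpha> + 5 * \<beta>) code) = card radical * card torsion"
proof -
  let ?K = "{d \<in> D. fst (snd d) \<in> radical}"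
  have "card (code_kernel (\<alpha> + 5 * \<beta>) code) = card ?K"
    unfolding code_kernel_eq by (rule card_image[OF inj_on_gamma_D]) auto
  moreover have "(\<lambda>d. fst (snd d)) ` ?K = radical"
    by (force simp: radical_def lows_def)
  moreover have "card {t \<in> ?K. fst (snd t) = fst (snd s)} = card torsion" if s: "s \<in> ?K" for s
  proof -
    obtain x l h where "s = (x, l, h)" by (cases s)
    moreover have "{t \<in> ?K. fst (snd t) = fst (snd s)} = {t \<in> D. fst (snd t) = fst (snd s)}"
      using s by auto
    ultimately show ?thesis using s card_fiber_torsion[of x l h] by simp
  qed
  ultimately show ?thesis
    using card_eq_card_image_mult[of ?K "\<lambda>d. fst (snd d)" "card torsion"] finite_D by simp
qed

lemma subspace_code_kernel: "z5v.subspace (code_kernel (\<alpha> + 5 * \<beta>) code)"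
proof (rule subspace_if_add_closed)
  let ?n = "\<alpha> + 5 * \<beta>"
  show "0 \<in> code_kernel ?n code"
    by (simp add: code_kernel_def space5_def)
  fix x y assume xy: "x \<in> code_kernel ?n code" "y \<in> code_kernel ?n code"
  have "(\<lambda>c. c + (x + y)) ` code = (\<lambda>c. c + y) ` (\<lambda>c. c + x) ` code"
    by (simp add: image_image add.assoc)
  also have "\<dots> = code"
    using xy by (simp add: code_kernel_def)
  finally show "x + y \<in> code_kernel ?n code"
    using xy z5v.subspace_add[OF subspace_space5] by (simp add: code_kernel_def)
qed

text \<open>A linear sum of two codewords is their group sum minus a carry, and
  \<open>envelope\<close> absorbs that carry. Conversely, the image of a carry is the group sum
  minus the two summands, hence lies in the span.\<close>

lemma span_code:
  "z5v.span code = (\<lambda>((x, l, h), q). \<Gamma> x l (h + q)) ` (D \<times> envelope)" (is "_ = ?S")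
proof (rule subset_antisym)
  have S: "\<Gamma> x l (h + q) \<in> ?S" if "(x, l, h) \<in> D" "q \<in> envelope" for x l h q
    using that by (intro image_eqI[of _ _ "((x, l, h), q)"]) auto
  have "z5v.subspace ?S"
  proof (rule subspace_if_add_closed)
    show "0 \<in> ?S"
      using S[OF zero z5v.subspace_0[OF subspace_envelope]] by (simp only: add_0 gamma_0)
    fix v w assume "v \<in> ?S" "w \<in> ?S"
    then obtain x l h q x' l' h' q'
      where v: "(x, l, h) \<in> D" "q \<in> envelope" "v = \<Gamma> x l (h + q)"
        and w: "(x', l', h') \<in> D" "q' \<in> envelope" "w = \<Gamma> x' l' (h' + q')"
      by auto
    have "vcarry l l' \<in> envelope"
      using v(1) w(1) by (intro vcarry_in_envelope) (auto simp: lows_def)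
    then have "q + q' - vcarry l l' \<in> envelope"
      using v(2) w(2) subspace_envelope by (intro z5v.subspace_add z5v.subspace_diff)
    from S[OF add[OF v(1) w(1)] this]
    have "\<Gamma> (x + x') (l + l') (h + h' + vcarry l l' + (q + q' - vcarry l l')) \<in> ?S" .
    moreover have "h + h' + vcarry l l' + (q + q' - vcarry l l') = (h + q) + (h' + q')"
      by simp
    ultimately show "v + w \<in> ?S"
      unfolding v(3) w(3) gamma_add by (simp only:)
  qed
  moreover have "code \<subseteq> ?S"
  proof
    fix v assume "v \<in> code"
    then obtain x l h where "(x, l, h) \<in> D" "v = \<Gamma> x l h"
      by (auto simp: code_def)
    then show "v \<in> ?S"
      using S[of x l h 0] z5v.subspace_0[OF subspace_envelope] by (simp only: add_0_right)
  qed
  ultimately show "z5v.span code \<subseteq> ?S"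
    by (intro z5v.span_minimal)
  have base: "\<Gamma> x l h \<in> z5v.span code" if "(x, l, h) \<in> D" for x l h
    using that by (intro z5v.span_base) (force simp: code_def)
  have "envelope \<subseteq> {q. \<Gamma> 0 0 q \<in> z5v.span code}"
    unfolding envelope_def
  proof (rule z5v.span_minimal)
    show "z5v.subspace {q. \<Gamma> 0 0 q \<in> z5v.span code}"
    proof (rule subspace_if_add_closed)
      show "0 \<in> {q. \<Gamma> 0 0 q \<in> z5v.span code}"
        using base[OF zero] by simp
      fix q r assume "q \<in> {q. \<Gamma> 0 0 q \<in> z5v.span code}" "r \<in> {q. \<Gamma> 0 0 q \<in> z5v.span code}"
      then have "\<Gamma> 0 0 q + \<Gamma> 0 0 r \<in> z5v.span code"
        by (simp only: mem_Collect_eq z5v.span_add)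
      then show "q + r \<in> {q. \<Gamma> 0 0 q \<in> z5v.span code}"
        unfolding gamma_add by (simp only: mem_Collect_eq add_0)
    qed
    have "\<Gamma> 0 0 (vcarry l l') \<in> z5v.span code" if l: "l \<in> lows" "l' \<in> lows" for l l'
    proof -
      obtain x h x' h' where d: "(x, l, h) \<in> D" "(x', l', h') \<in> D"
        using l by (auto simp: lows_def)
      have "\<Gamma> (x + x') (l + l') (h + h' + vcarry l l') = \<Gamma> x l h + \<Gamma> x' l' h' + \<Gamma> 0 0 (vcarry l l')"
        by (simp only: gamma_add add_0_right)
      then have "\<Gamma> 0 0 (vcarry l l') =
          \<Gamma> (x + x') (l + l') (h + h' + vcarry l l') - \<Gamma> x l h - \<Gamma> x' l' h'"
        by simp
      then show ?thesis
        using base[OF add[OF d]] base[OF d(1)] base[OF d(2)] by (simp only: z5v.span_diff)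
    qed
    then show "highs \<union> carries \<subseteq> {q. \<Gamma> 0 0 q \<in> z5v.span code}"
      using base[of 0 0] by (auto simp: highs_def carries_def)
  qed
  then have q: "\<Gamma> 0 0 q \<in> z5v.span code" if "q \<in> envelope" for q
    using that by auto
  show "?S \<subseteq> z5v.span code"
  proof
    fix v assume "v \<in> ?S"
    then obtain x l h q' where v: "(x, l, h) \<in> D" "q' \<in> envelope" "v = \<Gamma> x l (h + q')"
      by auto
    have "v = \<Gamma> x l h + \<Gamma> 0 0 q'"
      unfolding v(3) by (simp only: gamma_add add_0_right)
    then show "v \<in> z5v.span code"
      using base[OF v(1)] q[OF v(2)] by (simp only: z5v.span_add)
  qed
qed

lemma card_span_code: "card D * card envelope = card (z5v.span code) * card highs"
proof -
  let ?g = "\<lambda>((x, l, h), q). \<Gamma> x l (h + q)"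
  have "card {t \<in> D \<times> envelope. ?g t = ?g s} = card highs" if s: "s \<in> D \<times> envelope" for s
  proof -
    obtain x l h q where s': "s = ((x, l, h), q)" "(x, l, h) \<in> D" "q \<in> envelope"
      using s by auto
    \<comment> \<open>Two representations of the same vector differ by moving an element
      \<open>p\<close> of P from \<open>q\<close> to \<open>h\<close>.\<close>
    have "bij_betw (\<lambda>p. ((x, l, h + p), q - p)) highs {t \<in> D \<times> envelope. ?g t = ?g s}"
    proof (rule bij_betw_imageI)
      show "inj_on (\<lambda>p. ((x, l, h + p), q - p)) highs"
        by (auto simp: inj_on_def)
      show "(\<lambda>p. ((x, l, h + p), q - p)) ` highs = {t \<in> D \<times> envelope. ?g t = ?g s}"
      proof (rule subset_antisym; rule subsetI)
        fix t assume "t \<in> (\<lambda>p. ((x, l, h + p), q - p)) ` highs"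
        then obtain p where p: "p \<in> highs" "t = ((x, l, h + p), q - p)" by auto
        have "(x, l, h + p) \<in> D"
          using shift_in_D[OF s'(2), of 0 p] p by (simp add: highs_def)
        moreover have "q - p \<in> envelope"
          using p(1) highs_subset_envelope s'(3) z5v.subspace_diff[OF subspace_envelope] by blast
        ultimately show "t \<in> {t \<in> D \<times> envelope. ?g t = ?g s}"
          unfolding p(2) s'(1) by simp
      next
        fix t assume t: "t \<in> {t \<in> D \<times> envelope. ?g t = ?g s}"
        obtain x' l' h' q' where t': "t = ((x', l', h'), q')" by (cases t) auto
        have t'': "(x', l', h') \<in> D" "q' \<in> envelope" "\<Gamma> x' l' (h' + q') = \<Gamma> x l (h + q)"
          using t unfolding t' s'(1) by auto
        have "h + q \<in> space5 \<beta>" "h' + q' \<in> space5 \<beta>"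
          using support[OF s'(2)] support[OF t''(1)] s'(3) t''(2) envelope_subset
            z5v.subspace_add[OF subspace_space5] by blast+
        then have eq: "x' = x \<and> l' = l \<and> h' + q' = h + q"
          using support[OF s'(2)] support[OF t''(1)] gamma_eqD[OF t''(3) Y] by blast
        then have "h' - h \<in> highs"
          using diff_in_D[of x l h' x h] t''(1) s'(2) by (simp add: highs_def)
        moreover have "q' = q - (h' - h)"
        proof -
          have "q' = (h' + q') - h'" by simp
          also have "\<dots> = (h + q) - h'" using eq by (simp only:)
          finally show ?thesis by (simp add: algebra_simps)
        qed
        ultimately show "t \<in> (\<lambda>p. ((x, l, h + p), q - p)) ` highs"
          unfolding t' using eq by (intro image_eqI[of _ _ "h' - h"]) simp_all
      qed
    qed
    then show ?thesis by (simp add: bij_betw_same_card)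
  qed
  then have "card (D \<times> envelope) = card (?g ` (D \<times> envelope)) * card highs"
    using finite_D finite_subspaces by (intro card_eq_card_image_mult) auto
  then show ?thesis
    unfolding span_code[symmetric] by (simp add: card_cartesian_product)
qed

end

text \<open>These are the successive carries when five copies of \<open>a\<close> are added. The
  total is 5a, whose low digit is 0 and whose high digit is \<open>a\<close>.\<close>

lemma carry_multiples_sum: "carry a a + carry (a + a) a + carry (a + a + a) a + carry (a + a + a + a) a = a"
proof -
  obtain n where n: "a = of_int n" "n \<in> {0, 1, 2, 3, 4}"
    by (rule z5_cases)
  show ?thesis
    unfolding n(1) of_int_add[symmetric] carry_of_int z5_of_int_eq_iff using n(2) by auto
qed

lemma z5_sum_5: "a + a + a + a + a = (0 :: z5)"
proof -
  obtain n where n: "a = of_int n" "n \<in> {0, 1, 2, 3, 4}"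
    by (rule z5_cases)
  show ?thesis
    unfolding n(1) of_int_add[symmetric] z5_of_int_eq_0_iff using n(2) by auto
qed

context carry_code
begin

text \<open>Multiplication by \<open>5\<close> turns the low digits into high digits.\<close>

lemma lows_subset_highs: "lows \<subseteq> highs"
proof
  fix l assume "l \<in> lows"
  then obtain x h where d: "(x, l, h) \<in> D" by (auto simp: lows_def)
  have 5: "v + v + v + v + v = 0" for v :: "nat \<Rightarrow> z5"
    by (simp only: fun_eq_iff plus_fun_apply z5_sum_5 zero_fun_apply) simp
  have "(x + x + x + x + x, l + l + l + l + l,
      h + h + vcarry l l + h + vcarry (l + l) l + h + vcarry (l + l + l) l + h
        + vcarry (l + l + l + l) l) \<in> D"
    by (intro add d)
  moreover have "h + h + vcarry l l + h + vcarry (l + l) l + h + vcarry (l + l + l) l + h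
        + vcarry (l + l + l + l) l = (h + h + h + h + h)
        + (vcarry l l + vcarry (l + l) l + vcarry (l + l + l) l + vcarry (l + l + l + l) l)"
    by (simp add: algebra_simps)
  moreover have "vcarry l l + vcarry (l + l) l + vcarry (l + l + l) l + vcarry (l + l + l + l) l = l"
    by (simp only: vcarry_def fun_eq_iff plus_fun_apply carry_multiples_sum) simp
  ultimately have "(0, 0, l) \<in> D"
    by (simp only: 5 add_0)
  then show "l \<in> highs" by (simp add: highs_def)
qed

section \<open>Dimension formulas and bounds for kernel and rank\<close>

lemma card_power_eqs:
  shows "card lows = 5 ^ z5v.dim lows" "card highs = 5 ^ z5v.dim highs"
    "card envelope = 5 ^ z5v.dim envelope" "card radical = 5 ^ z5v.dim radical"
    "card torsion_proj = 5 ^ z5v.dim torsion_proj"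
    "card (code_kernel (\<alpha> + 5 * \<beta>) code) = 5 ^ code_ker (\<alpha> + 5 * \<beta>) code"
    "card (z5v.span code) = 5 ^ code_rank code"
proof -
  show "card lows = 5 ^ z5v.dim lows" "card highs = 5 ^ z5v.dim highs"
    "card envelope = 5 ^ z5v.dim envelope" "card radical = 5 ^ z5v.dim radical"
    "card torsion_proj = 5 ^ z5v.dim torsion_proj"
    using card_subspace finite_subspaces subspace_lows subspace_highs subspace_envelope
      subspace_radical subspace_torsion_proj by blast+
  have "finite (code_kernel (\<alpha> + 5 * \<beta>) code)"
    by (rule finite_subset[OF _ conjunct1[OF finite_card_space5]]) (auto simp: code_kernel_def)
  then show "card (code_kernel (\<alpha> + 5 * \<beta>) code) = 5 ^ code_ker (\<alpha> + 5 * \<beta>) code"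
    unfolding code_ker_def using card_subspace subspace_code_kernel by blast
  have "finite (z5v.span code)"
    unfolding span_code using finite_D finite_subspaces by blast
  then show "card (z5v.span code) = 5 ^ code_rank code"
    unfolding code_rank_def using card_subspace[of "z5v.span code"] z5v.dim_span[of "z5v.span code"]
      z5v.subspace_span by blast
qed

text \<open>The four equalities compare exponents of 5 in \<open>card_D\<close>,
  \<open>card_torsion\<close>, \<open>card_code_kernel\<close> and \<open>card_span_code\<close>, in
  this order.\<close>

lemma parameters:
  assumes "card D = 5 ^ (\<gamma> + 2 * \<delta>)" "card torsion = 5 ^ (\<gamma> + \<delta>)" "z5v.dim torsion_proj = \<kappa>"
  shows "z5v.dim lows = \<delta>" "\<kappa> + z5v.dim highs = \<gamma> + \<delta>"
    "code_ker (\<alpha> + 5 * \<beta>) code = \<gamma> + \<delta> + z5v.dim radical"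
    "code_rank code + z5v.dim highs = \<gamma> + 2 * \<delta> + z5v.dim envelope"
proof -
  have "(5::nat) ^ (\<gamma> + 2 * \<delta>) = 5 ^ (z5v.dim lows + (\<gamma> + \<delta>))"
    using card_D assms card_power_eqs by (simp add: power_add)
  then show "z5v.dim lows = \<delta>"
    by (simp only: power_inject_exp)
  have "(5::nat) ^ (\<gamma> + \<delta>) = 5 ^ (\<kappa> + z5v.dim highs)"
    using card_torsion assms card_power_eqs by (simp add: power_add)
  then show "\<kappa> + z5v.dim highs = \<gamma> + \<delta>"
    by simp
  have "(5::nat) ^ code_ker (\<alpha> + 5 * \<beta>) code = 5 ^ (z5v.dim radical + (\<gamma> + \<delta>))"
    using card_code_kernel assms card_power_eqs by (simp add: power_add)
  then show "code_ker (\<alpha> + 5 * \<beta>) code = \<gamma> + \<delta> + z5v.dim radical"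
    by simp
  have "(5::nat) ^ (\<gamma> + 2 * \<delta> + z5v.dim envelope) = 5 ^ (code_rank code + z5v.dim highs)"
    using card_span_code assms card_power_eqs by (simp add: power_add)
  then show "code_rank code + z5v.dim highs = \<gamma> + 2 * \<delta> + z5v.dim envelope"
    by simp
qed

lemma dim_radical_le: "z5v.dim radical \<le> z5v.dim lows"
  using subspace_radical subspace_lows finite_subspaces
  by (intro dim_mono_finite) (auto simp: radical_def)

lemma dim_highs_le: "z5v.dim highs \<le> z5v.dim envelope"
  using subspace_highs subspace_envelope finite_subspaces highs_subset_envelope
  by (intro dim_mono_finite)

lemma dim_envelope_le: "z5v.dim envelope \<le> \<beta>"
  using dim_mono_finite[OF subspace_envelope subspace_space5 _ envelope_subset] finite_card_space5
  by simp

text \<open>Both equalities say that every carry of two elements of L lies in P. This makes the two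
  excesses vanish simultaneously.\<close>

lemma trivial_iff:
  "z5v.dim envelope = z5v.dim highs \<longleftrightarrow> z5v.dim radical = z5v.dim lows"
proof -
  have "z5v.dim envelope = z5v.dim highs \<longleftrightarrow> highs = envelope"
    using subspace_eqI[OF subspace_highs subspace_envelope] finite_subspaces highs_subset_envelope
    by metis
  also have "\<dots> \<longleftrightarrow> (\<forall>l\<in>lows. \<forall>m\<in>lows. vcarry l m \<in> highs)"
  proof
    assume "\<forall>l\<in>lows. \<forall>m\<in>lows. vcarry l m \<in> highs"
    then have "envelope \<subseteq> highs"
      unfolding envelope_def by (intro z5v.span_minimal subspace_highs) (auto simp: carries_def)
    then show "highs = envelope" using highs_subset_envelope by blast
  qed (use vcarry_in_envelope in auto)
  also have "\<dots> \<longleftrightarrow> radical = lows"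
    by (auto simp: radical_def)
  also have "\<dots> \<longleftrightarrow> z5v.dim radical = z5v.dim lows"
    using subspace_eqI[OF subspace_radical subspace_lows] finite_subspaces
    by (metis (no_types, lifting) mem_Collect_eq radical_def subsetI)
  finally show ?thesis .
qed

text \<open>The cocycle identity again. An arbitrary subspace \<open>S\<close> containing P is
  allowed so that the lemma applies to P enlarged by monomials.\<close>

lemma vcarry_radical_shift:
  assumes "m \<in> radical" "x \<in> lows" "y \<in> lows" "vcarry x y \<in> S" "highs \<subseteq> S" "z5v.subspace S"
  shows "vcarry (m + x) y \<in> S"
proof -
  have eq: "vcarry (m + x) y = vcarry x y + vcarry m (x + y) - vcarry m x"
    using vcarry_cocycle[of m x y] by (simp add: algebra_simps)
  have "vcarry m (x + y) \<in> S" "vcarry m x \<in> S"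
    using assms(1-3,5) z5v.subspace_add[OF subspace_lows] by (auto simp: radical_def)
  then show ?thesis
    unfolding eq using assms(4,6) by (intro z5v.subspace_add z5v.subspace_diff)
qed

text \<open>Modulo the high digits, a carry depends only on the classes of its arguments modulo the
  radical, and it is a combination of monomials in a basis of representatives.\<close>

lemma dim_envelope_le_nonlin:
  "z5v.dim envelope \<le> z5v.dim highs + card (nonlin (z5v.dim lows - z5v.dim radical))"
proof -
  obtain R where R: "R \<subseteq> radical" "finite R" "z5v.independent R" "z5v.span R = radical"
      "card R = z5v.dim radical"
    using subspace_basis[OF subspace_radical] finite_subspaces by metis
  have rl: "radical \<subseteq> lows" by (auto simp: radical_def)
  \<comment> \<open>A basis of M is extended to one of L; the added vectors \<open>B - R\<close>
    represent a basis of L modulo M and serve as the variables of the monomials.\<close>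
  obtain B where B: "R \<subseteq> B" "B \<subseteq> lows" "z5v.independent B" "lows \<subseteq> z5v.span B"
    using z5v.maximal_independent_subset_extend[of R lows] R(1,3) rl by blast
  have finB: "finite B" using B(2) finite_subspaces finite_subset by blast
  have "card B = z5v.dim lows"
    using z5v.basis_card_eq_dim[OF B(2,4,3)] .
  then have cardBR: "card (B - R) = z5v.dim lows - z5v.dim radical"
    using R B(1) by (simp add: card_Diff_subset)
  define k where "k = z5v.dim lows - z5v.dim radical"
  obtain b where b: "bij_betw b {..<k} (B - R)"
    using ex_bij_betw_nat_finite[of "B - R"] finB cardBR by (auto simp: k_def atLeast0LessThan)
  have img: "b ` {..<k} = B - R"
    using b by (simp add: bij_betw_def)
  obtain H where H: "H \<subseteq> highs" "finite H" "z5v.span H = highs" "card H = z5v.dim highs"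
    using subspace_basis[OF subspace_highs] finite_subspaces by metis
  let ?S = "z5v.span (mon b ` nonlin k \<union> H)"
  have HS: "highs \<subseteq> ?S"
    unfolding H(3)[symmetric] by (rule z5v.span_mono) simp
  have BR: "z5v.span (B - R) \<subseteq> lows"
    using B(2) by (intro z5v.span_minimal subspace_lows) auto
  \<comment> \<open>The variables lie in L and therefore in P, so the linear terms, and with them
    the fifth powers, cost no additional dimension.\<close>
  have "b ` {..<k} \<subseteq> ?S"
    unfolding img using B(2) lows_subset_highs HS by blast
  then have "z5v.span (mon b ` nonlin k \<union> b ` {..<k}) \<subseteq> ?S"
    by (intro z5v.span_minimal) (auto intro: z5v.span_base)
  then have carry: "vcarry x y \<in> ?S" if "x \<in> z5v.span (B - R)" "y \<in> z5v.span (B - R)" for x y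
    using vcarry_in_span_nonlin[of x b k y] that unfolding img by blast
  have "vcarry l l' \<in> ?S" if l: "l \<in> lows" "l' \<in> lows" for l l'
  proof -
    have "lows \<subseteq> z5v.span (R \<union> (B - R))"
      using B(1,4) by (simp add: Un_absorb1)
    then obtain m x m' x' where
      mx: "m \<in> radical" "x \<in> z5v.span (B - R)" "l = m + x"
        "m' \<in> radical" "x' \<in> z5v.span (B - R)" "l' = m' + x'"
      using l unfolding z5v.span_Un R(4) by blast
    \<comment> \<open>The component in M is removed from the second argument first; commutativity
      then allows the same for the first argument.\<close>
    have "vcarry (m' + x') x \<in> ?S"
      using mx BR HS carry by (intro vcarry_radical_shift) auto
    then have "vcarry x l' \<in> ?S"
      unfolding mx(6) by (simp only: vcarry_commute)
    then show ?thesis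
      unfolding mx(3) using mx(1,2) BR HS l by (intro vcarry_radical_shift) auto
  qed
  then have "envelope \<subseteq> ?S"
    unfolding envelope_def using HS by (intro z5v.span_minimal) (auto simp: carries_def)
  then have "z5v.dim envelope \<le> card (mon b ` nonlin k \<union> H)"
    using H(2) finite_nonlin by (intro z5v.dim_le_card) auto
  also have "\<dots> \<le> card (mon b ` nonlin k) + card H"
    by (rule card_Un_le)
  also have "\<dots> \<le> card (nonlin k) + z5v.dim highs"
    using card_image_le[OF finite_nonlin] H(4) by simp
  finally show ?thesis by (simp add: k_def)
qed

end

section \<open>Additive codes and their base-5 digits\<close>

lemma mixed_group_carrier:
  "carrier (mixed_group a b) = (PiE {..<a} (\<lambda>_. {0..<5})) \<times> (PiE {..<b} (\<lambda>_. {0..<25}))"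
  by (simp add: mixed_group_def carrier_integer_mod_group)

lemma mixed_group_mult:
  "c \<otimes>\<^bsub>mixed_group a b\<^esub> d =
    ((\<lambda>i\<in>{..<a}. (fst c i + fst d i) mod 5), (\<lambda>i\<in>{..<b}. (snd c i + snd d i) mod 25))"
  by (cases c, cases d) (simp add: mixed_group_def)

lemma mixed_group_one:
  "\<one>\<^bsub>mixed_group a b\<^esub> = ((\<lambda>i\<in>{..<a}. 0), (\<lambda>i\<in>{..<b}. 0))"
  by (simp add: mixed_group_def)

lemma group_mixed_group: "group (mixed_group a b)"
  unfolding mixed_group_def by (intro DirProd_group product_group group_integer_mod_group)

lemma mixed_group_pow:
  fixes n :: nat
  shows "c [^]\<^bsub>mixed_group a b\<^esub> n =
    ((\<lambda>i\<in>{..<a}. (int n * fst c i) mod 5), (\<lambda>i\<in>{..<b}. (int n * snd c i) mod 25))"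
proof (induction n)
  case 0
  then show ?case by (simp add: mixed_group_one restrict_def)
next
  case (Suc n)
  then show ?case
    by (auto simp: mixed_group_mult restrict_def fun_eq_iff mod_simps algebra_simps)
qed

lemma mixed_group_pow_5_eq_one:
  "c [^]\<^bsub>mixed_group a b\<^esub> (5::nat) = \<one>\<^bsub>mixed_group a b\<^esub> \<longleftrightarrow> (\<forall>i<b. 5 dvd snd c i)"
proof -
  have "5 * y mod 25 = 0 \<longleftrightarrow> 5 dvd y" for y :: int
    by presburger
  then show ?thesis
    unfolding mixed_group_pow mixed_group_one by (auto simp: fun_eq_iff restrict_def)
qed

lemma card_mixed_group: "card (carrier (mixed_group a b)) = 5 ^ (a + 2 * b)"
  by (simp add: mixed_group_carrier card_cartesian_product card_PiE power_add power_mult)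

lemma card_mixed_group_torsion:
  "card {c \<in> carrier (mixed_group a b). c [^]\<^bsub>mixed_group a b\<^esub> (5::nat) = \<one>\<^bsub>mixed_group a b\<^esub>}
    = 5 ^ (a + b)"
proof -
  have "{c \<in> carrier (mixed_group a b). c [^]\<^bsub>mixed_group a b\<^esub> (5::nat) = \<one>\<^bsub>mixed_group a b\<^esub>}
    = (PiE {..<a} (\<lambda>_. {0..<5})) \<times> (PiE {..<b} (\<lambda>_. {y \<in> {0..<25}. 5 dvd y}))"
    unfolding mixed_group_pow_5_eq_one mixed_group_carrier
    by (auto simp: PiE_iff)
  moreover have "{y \<in> {0..<25}. 5 dvd y} = {0, 5, 10, 15, 20 :: int}"
    by (simp add: set_eq_iff) presburger
  moreover have "card {0, 5, 10, 15, 20 :: int} = 5"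
    by simp
  ultimately show ?thesis
    by (simp only: card_cartesian_product card_PiE finite_lessThan prod_constant card_lessThan
        card_atLeastLessThan_int power_add) simp
qed

section \<open>Base-5 digits of additive codes\<close>

definition low :: "nat \<Rightarrow> (nat \<Rightarrow> int) \<times> (nat \<Rightarrow> int) \<Rightarrow> nat \<Rightarrow> z5"
  where "low \<beta> c = (\<lambda>k. if k < \<beta> then of_int (snd c k) else 0)"

definition high :: "nat \<Rightarrow> (nat \<Rightarrow> int) \<times> (nat \<Rightarrow> int) \<Rightarrow> nat \<Rightarrow> z5"
  where "high \<beta> c = (\<lambda>k. if k < \<beta> then of_int (snd c k div 5) else 0)"

definition digits where "digits \<alpha> \<beta> c = (z5_part \<alpha> c, low \<beta> c, high \<beta> c)"

lemma digits_support:
  "z5_part \<alpha> c \<in> space5 \<alpha>" "low \<beta> c \<in> space5 \<beta>" "high \<beta> c \<in> space5 \<beta>"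
  by (simp_all add: z5_part_def low_def high_def space5_def)

lemma z5_of_int_inj: "(of_int a :: z5) = of_int b \<Longrightarrow> a \<in> {0..<5} \<Longrightarrow> b \<in> {0..<5} \<Longrightarrow> a = b"
  by (simp add: z5_of_int_eq_iff)

lemma digits_inj: "inj_on (digits \<alpha> \<beta>) (carrier (mixed_group \<alpha> \<beta>))"
proof (rule inj_onI)
  fix c d assume c: "c \<in> carrier (mixed_group \<alpha> \<beta>)" and d: "d \<in> carrier (mixed_group \<alpha> \<beta>)"
    and eq: "digits \<alpha> \<beta> c = digits \<alpha> \<beta> d"
  have fst: "fst c \<in> PiE {..<\<alpha>} (\<lambda>_. {0..<5})" "fst d \<in> PiE {..<\<alpha>} (\<lambda>_. {0..<5})"
    and snd: "snd c \<in> PiE {..<\<beta>} (\<lambda>_. {0..<25})" "snd d \<in> PiE {..<\<beta>} (\<lambda>_. {0..<25})"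
    using c d by (simp_all only: mixed_group_carrier mem_Times_iff)
  have "fst c i = fst d i" if i: "i \<in> {..<\<alpha>}" for i
  proof (rule z5_of_int_inj)
    have "z5_part \<alpha> c i = z5_part \<alpha> d i" using eq by (simp add: digits_def)
    then show "(of_int (fst c i) :: z5) = of_int (fst d i)" using i by (simp add: z5_part_def)
  qed (use PiE_mem[OF fst(1) i] PiE_mem[OF fst(2) i] in auto)
  then have "fst c = fst d"
    by (rule PiE_ext[OF fst])
  moreover have "snd c i = snd d i" if i: "i \<in> {..<\<beta>}" for i
  proof -
    have "low \<beta> c i = low \<beta> d i" "high \<beta> c i = high \<beta> d i" using eq by (simp_all add: digits_def)
    then have "snd c i mod 5 = snd d i mod 5" "snd c i div 5 mod 5 = snd d i div 5 mod 5"
      using i by (simp_all add: low_def high_def z5_of_int_eq_iff)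
    moreover have "snd c i \<in> {0..<25}" "snd d i \<in> {0..<25}"
      using PiE_mem[OF snd(1) i] PiE_mem[OF snd(2) i] by auto
    then have "snd c i div 5 mod 5 = snd c i div 5" "snd d i div 5 mod 5 = snd d i div 5"
      by (auto intro!: mod_pos_pos_trivial)
    ultimately show ?thesis
      by (metis mult_div_mod_eq)
  qed
  then have "snd c = snd d"
    by (rule PiE_ext[OF snd])
  ultimately show "c = d" by (simp add: prod_eq_iff)
qed

lemma digits_mult:
  "digits \<alpha> \<beta> (c \<otimes>\<^bsub>mixed_group \<alpha> \<beta>\<^esub> d) =
    (z5_part \<alpha> c + z5_part \<alpha> d, low \<beta> c + low \<beta> d,
     high \<beta> c + high \<beta> d + vcarry (low \<beta> c) (low \<beta> d))"
proof -
  have "(of_int (a mod 25) :: z5) = of_int a" for a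
    unfolding z5_of_int_eq_iff by (simp add: mod_mod_cancel)
  then have "z5_part \<alpha> (c \<otimes>\<^bsub>mixed_group \<alpha> \<beta>\<^esub> d) i = (z5_part \<alpha> c + z5_part \<alpha> d) i"
    "low \<beta> (c \<otimes>\<^bsub>mixed_group \<alpha> \<beta>\<^esub> d) i = (low \<beta> c + low \<beta> d) i"
    "high \<beta> (c \<otimes>\<^bsub>mixed_group \<alpha> \<beta>\<^esub> d) i =
      (high \<beta> c + high \<beta> d + vcarry (low \<beta> c) (low \<beta> d)) i" for i
    using z25_digits_add[of "snd c i" "snd d i"]
    by (simp_all add: z5_part_def low_def high_def vcarry_def mixed_group_mult)
  then show ?thesis
    by (simp only: digits_def fun_eq_iff prod.inject simp_thms)
qed

lemma digits_one: "digits \<alpha> \<beta> \<one>\<^bsub>mixed_group \<alpha> \<beta>\<^esub> = (0, 0, 0)"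
  by (auto simp: digits_def z5_part_def low_def high_def mixed_group_one fun_eq_iff)

lemma Gray_eq_gamma: "Gray Y \<alpha> \<beta> c = gamma Y \<alpha> \<beta> (z5_part \<alpha> c) (low \<beta> c) (high \<beta> c)"
proof
  fix i
  have "(i - \<alpha>) div 5 < \<beta>" if "\<not> i < \<alpha>" "i < \<alpha> + 5 * \<beta>"
    using that by linarith
  then show "Gray Y \<alpha> \<beta> c i = gamma Y \<alpha> \<beta> (z5_part \<alpha> c) (low \<beta> c) (high \<beta> c) i"
    by (simp add: Gray_def gamma_def gray_def z5_part_def low_def high_def)
qed

lemma carry_code_digits:
  assumes "additive_code \<alpha> \<beta> A" "Y 0 \<noteq> Y 1"
  shows "carry_code Y \<alpha> \<beta> (digits \<alpha> \<beta> ` A)"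
proof -
  let ?G = "mixed_group \<alpha> \<beta>"
  interpret group ?G by (rule group_mixed_group)
  have A: "subgroup A ?G" using assms(1) by (simp add: additive_code_def)
  show ?thesis
  proof
    show "Y 0 \<noteq> Y 1" by fact
    show "x \<in> space5 \<alpha> \<and> l \<in> space5 \<beta> \<and> h \<in> space5 \<beta>" if "(x, l, h) \<in> digits \<alpha> \<beta> ` A" for x l h
      using that digits_support by (auto simp: digits_def)
    show "(0, 0, 0) \<in> digits \<alpha> \<beta> ` A"
      using subgroup.one_closed[OF A] digits_one by (metis imageI)
    show "(x + x', l + l', h + h' + vcarry l l') \<in> digits \<alpha> \<beta> ` A"
      if d: "(x, l, h) \<in> digits \<alpha> \<beta> ` A" "(x', l', h') \<in> digits \<alpha> \<beta> ` A" for x l h x' l' h'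
    proof -
      obtain c c' where c: "c \<in> A" "(x, l, h) = digits \<alpha> \<beta> c" "c' \<in> A" "(x', l', h') = digits \<alpha> \<beta> c'"
        using d by blast
      then have "digits \<alpha> \<beta> (c \<otimes>\<^bsub>?G\<^esub> c') = (x + x', l + l', h + h' + vcarry l l')"
        using digits_mult[of \<alpha> \<beta> c c'] by (simp add: digits_def)
      then show ?thesis
        using subgroup.m_closed[OF A c(1,3)] by (metis imageI)
    qed
    show "(- x, - l, - h - vcarry l (- l)) \<in> digits \<alpha> \<beta> ` A" if d: "(x, l, h) \<in> digits \<alpha> \<beta> ` A" for x l h
    proof -
      obtain c where c: "c \<in> A" "(x, l, h) = digits \<alpha> \<beta> c"
        using d by blast
      let ?d = "inv\<^bsub>?G\<^esub> c"
      have inv: "?d \<in> A"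
        using subgroup.m_inv_closed[OF A c(1)] .
      \<comment> \<open>The digits of the inverse are not computed from negatives modulo 25 but read
        off from the digits of the product with \<open>c\<close>, which are zero.\<close>
      have "c \<otimes>\<^bsub>?G\<^esub> ?d = \<one>\<^bsub>?G\<^esub>"
        using subgroup.mem_carrier[OF A c(1)] by simp
      then have "(x + z5_part \<alpha> ?d, l + low \<beta> ?d, h + high \<beta> ?d + vcarry l (low \<beta> ?d)) = (0, 0, 0)"
        using digits_mult[of \<alpha> \<beta> c ?d] c(2) digits_one[of \<alpha> \<beta>]
        by (simp only: digits_def prod.inject)
      then have "x + z5_part \<alpha> ?d = 0" "l + low \<beta> ?d = 0"
          "h + high \<beta> ?d + vcarry l (low \<beta> ?d) = 0"
        by (simp_all only: prod.inject)
      then have eq: "- x = z5_part \<alpha> ?d" "- l = low \<beta> ?d"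
          "- h - vcarry l (low \<beta> ?d) = high \<beta> ?d"
        by (simp_all only: eq_neg_iff_add_eq_0 neg_eq_iff_add_eq_0 diff_eq_eq) (simp add: neg_eq_iff_add_eq_0 algebra_simps)
      have "(- x, - l, - h - vcarry l (- l)) = digits \<alpha> \<beta> ?d"
        unfolding digits_def by (simp only: eq)
      then show ?thesis using inv by blast
    qed
  qed
qed

lemma low_eq_0_iff: "low \<beta> c = 0 \<longleftrightarrow> (\<forall>i<\<beta>. 5 dvd snd c i)"
  by (auto simp: low_def fun_eq_iff z5_of_int_eq_0_iff dvd_eq_mod_eq_0)

text \<open>The isomorphism is used only for two numbers it preserves: that of all elements and that
  of elements killed by 5. Both are counted in the model group.\<close>

lemma digits_parameters:
  assumes type: "additive_code_of_type \<alpha> \<beta> \<gamma> \<delta> \<kappa> A" and Y: "Y 0 \<noteq> Y 1"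
  shows "carry_code.code Y \<alpha> \<beta> (digits \<alpha> \<beta> ` A) = Gray Y \<alpha> \<beta> ` A"
    "card (digits \<alpha> \<beta> ` A) = 5 ^ (\<gamma> + 2 * \<delta>)"
    "card (carry_code.torsion (digits \<alpha> \<beta> ` A)) = 5 ^ (\<gamma> + \<delta>)"
    "z5v.dim (carry_code.torsion_proj (digits \<alpha> \<beta> ` A)) = \<kappa>"
proof -
  let ?G = "mixed_group \<alpha> \<beta>" and ?H = "mixed_group \<gamma> \<delta>"
  let ?tor = "{c \<in> A. c [^]\<^bsub>?G\<^esub> (5::nat) = \<one>\<^bsub>?G\<^esub>}"
  have A: "subgroup A ?G" and code: "additive_code \<alpha> \<beta> A"
    using type by (auto simp: additive_code_of_type_def additive_code_def)
  interpret carry_code Y \<alpha> \<beta> "digits \<alpha> \<beta> ` A"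
    using carry_code_digits[OF code Y] .
  have inj: "inj_on (digits \<alpha> \<beta>) A"
    using inj_on_subset[OF digits_inj subgroup.subset[OF A]] .
  show "code = Gray Y \<alpha> \<beta> ` A"
    unfolding code_def by (simp add: image_image digits_def Gray_eq_gamma)
  let ?A = "?G\<lparr>carrier := A\<rparr>"
  obtain f where f: "f \<in> iso ?A ?H"
    using type by (auto simp: additive_code_of_type_def is_iso_def)
  have gA: "group ?A"
    using group.subgroup_imp_group[OF group_mixed_group A] .
  interpret f: group_hom ?A ?H f
    using f gA group_mixed_group by (auto simp: group_hom_def group_hom_axioms_def iso_def)
  have bij: "bij_betw f A (carrier ?H)"
    using f by (simp add: iso_def)
  show "card (digits \<alpha> \<beta> ` A) = 5 ^ (\<gamma> + 2 * \<delta>)"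
    using card_image[OF inj] bij_betw_same_card[OF bij] card_mixed_group by simp
  have pow: "f c [^]\<^bsub>?H\<^esub> (5::nat) = \<one>\<^bsub>?H\<^esub> \<longleftrightarrow> c [^]\<^bsub>?G\<^esub> (5::nat) = \<one>\<^bsub>?G\<^esub>" if "c \<in> A" for c
  proof -
    have "f (c [^]\<^bsub>?A\<^esub> (5::nat)) = f c [^]\<^bsub>?H\<^esub> (5::nat)"
      using that by (intro f.hom_nat_pow) simp
    moreover have "c [^]\<^bsub>?A\<^esub> (5::nat) = c [^]\<^bsub>?G\<^esub> (5::nat)"
      by (simp add: nat_pow_def)
    moreover have "f \<one>\<^bsub>?G\<^esub> = \<one>\<^bsub>?H\<^esub>"
      using f.hom_one by simp
    moreover have "c [^]\<^bsub>?G\<^esub> (5::nat) \<in> A"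
      using monoid.nat_pow_closed[OF group.is_monoid[OF gA], of c 5] that
        \<open>c [^]\<^bsub>?A\<^esub> (5::nat) = c [^]\<^bsub>?G\<^esub> (5::nat)\<close> by simp
    moreover have "\<one>\<^bsub>?G\<^esub> \<in> A"
      using subgroup.one_closed[OF A] .
    ultimately show ?thesis
      using bij by (metis bij_betw_imp_inj_on inj_on_eq_iff)
  qed
  have "bij_betw f ?tor {c \<in> carrier ?H. c [^]\<^bsub>?H\<^esub> (5::nat) = \<one>\<^bsub>?H\<^esub>}"
  proof (rule bij_betw_imageI)
    show "inj_on f ?tor"
      using bij by (auto simp: bij_betw_def intro: inj_on_subset)
    show "f ` ?tor = {c \<in> carrier ?H. c [^]\<^bsub>?H\<^esub> (5::nat) = \<one>\<^bsub>?H\<^esub>}"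
      using pow unfolding bij_betw_imp_surj_on[OF bij, symmetric] by blast
  qed
  then have card_tor: "card ?tor = 5 ^ (\<gamma> + \<delta>)"
    using card_mixed_group_torsion by (simp add: bij_betw_same_card)
  have tor: "?tor = {c \<in> A. low \<beta> c = 0}"
    by (simp add: mixed_group_pow_5_eq_one low_eq_0_iff)
  have "torsion = (\<lambda>c. (z5_part \<alpha> c, high \<beta> c)) ` ?tor"
    unfolding tor torsion_def by (force simp: digits_def)
  moreover have "inj_on (\<lambda>c. (z5_part \<alpha> c, high \<beta> c)) ?tor"
  proof (rule inj_onI)
    fix c d assume "c \<in> ?tor" "d \<in> ?tor" "(z5_part \<alpha> c, high \<beta> c) = (z5_part \<alpha> d, high \<beta> d)"
    then show "c = d"
      using inj unfolding tor by (auto simp: inj_on_def digits_def)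
  qed
  ultimately show "card torsion = 5 ^ (\<gamma> + \<delta>)"
    using card_tor by (simp add: card_image)
  have "torsion_proj = z5_part \<alpha> ` ?tor"
    unfolding tor torsion_proj_def by (force simp: digits_def)
  then show "z5v.dim torsion_proj = \<kappa>"
    using type by (simp add: additive_code_of_type_def)
qed

section \<open>Interpolation by carry functions\<close>

lemma z5_numeral_5: "(5 :: z5) = 0"
  using z5_of_int_eq_0_iff[of 5] by simp

text \<open>Coefficients of a vector-valued polynomial in \<open>t\<close> of degree at most \<open>4\<close> without constant
  term are combinations of its values at \<open>1, \<dots>, 4\<close>; the weights are \<open>- t\<^sup>-\<^sup>a\<close>.\<close>

lemma separate_scalings:
  assumes F: "z5v.subspace F"
    and f: "\<And>t :: z5. scale5 t v1 + scale5 (t^2) v2 + scale5 (t^3) v3 + scale5 (t^4) v4 \<in> F"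
  shows "v1 \<in> F" "v2 \<in> F" "v3 \<in> F" "v4 \<in> F"
proof -
  define f where "f t = scale5 t v1 + scale5 (t^2) v2 + scale5 (t^3) v3 + scale5 (t^4) v4" for t
  have comb: "scale5 a (f 1) + scale5 b (f 2) + scale5 c (f 3) + scale5 d (f 4) \<in> F" for a b c d
    using f unfolding f_def[symmetric] by (intro z5v.subspace_add[OF F] z5v.subspace_scale[OF F])
  have val: "f 1 i = v1 i + v2 i + v3 i + v4 i"
    "f 2 i = 2 * v1 i + 4 * v2 i + 8 * v3 i + 16 * v4 i"
    "f 3 i = 3 * v1 i + 9 * v2 i + 27 * v3 i + 81 * v4 i"
    "f 4 i = 4 * v1 i + 16 * v2 i + 64 * v3 i + 256 * v4 i" for i
    by (simp_all add: f_def scale5_def)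
  \<comment> \<open>Whatever does not belong to the wanted coefficient is collected under a factor
    5, which is zero in the field.\<close>
  have "4 * f 1 i + 2 * f 2 i + 3 * f 3 i + 1 * f 4 i =
      v1 i + 5 * (4 * v1 i + 11 * v2 i + 33 * v3 i + 107 * v4 i)" for i
    unfolding val by (simp add: algebra_simps)
  then have "v1 = scale5 4 (f 1) + scale5 2 (f 2) + scale5 3 (f 3) + scale5 1 (f 4)"
    by (simp add: fun_eq_iff scale5_def z5_numeral_5)
  then show "v1 \<in> F" using comb by (simp only:)
  have "4 * f 1 i + 1 * f 2 i + 1 * f 3 i + 4 * f 4 i =
      v2 i + 5 * (5 * v1 i + 16 * v2 i + 59 * v3 i + 225 * v4 i)" for i
    unfolding val by (simp add: algebra_simps)
  then have "v2 = scale5 4 (f 1) + scale5 1 (f 2) + scale5 1 (f 3) + scale5 4 (f 4)"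
    by (simp add: fun_eq_iff scale5_def z5_numeral_5)
  then show "v2 \<in> F" using comb by (simp only:)
  have "4 * f 1 i + 3 * f 2 i + 2 * f 3 i + 1 * f 4 i =
      v3 i + 5 * (4 * v1 i + 10 * v2 i + 29 * v3 i + 94 * v4 i)" for i
    unfolding val by (simp add: algebra_simps)
  then have "v3 = scale5 4 (f 1) + scale5 3 (f 2) + scale5 2 (f 3) + scale5 1 (f 4)"
    by (simp add: fun_eq_iff scale5_def z5_numeral_5)
  then show "v3 \<in> F" using comb by (simp only:)
  have "4 * f 1 i + 4 * f 2 i + 4 * f 3 i + 4 * f 4 i =
      v4 i + 5 * (8 * v1 i + 24 * v2 i + 80 * v3 i + 283 * v4 i)" for i
    unfolding val by (simp add: algebra_simps)
  then have "v4 = scale5 4 (f 1) + scale5 4 (f 2) + scale5 4 (f 3) + scale5 4 (f 4)"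
    by (simp add: fun_eq_iff scale5_def z5_numeral_5)
  then show "v4 \<in> F" using comb by (simp only:)
qed

section \<open>Recovering products of linear forms from their carries\<close>

lemma unscale:
  assumes "z5v.subspace F" "scale5 c v \<in> F" "c \<noteq> 0"
  shows "v \<in> F"
  using z5v.subspace_scale[OF assms(1,2), of "inverse c"] assms(3) by simp

lemma z5_numerals_neq_0: "(2 :: z5) \<noteq> 0" "(3 :: z5) \<noteq> 0" "(4 :: z5) \<noteq> 0"
  using z5_of_int_eq_0_iff[of 2] z5_of_int_eq_0_iff[of 3] z5_of_int_eq_0_iff[of 4] by simp_all

context
  fixes F U :: "(nat \<Rightarrow> z5) set"
  assumes F: "z5v.subspace F" and U: "z5v.subspace U"
begin

text \<open>The coefficient of \<open>t\<close> in (x + tz)^2 w is 2xzw. It is isolated by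
  \<open>separate_scalings\<close>, and 2 is invertible. The next two lemmas do the same with the
  coefficients 3 and 4 for the third and fourth powers.\<close>

lemma polarize_2:
  assumes "\<And>x. x \<in> U \<Longrightarrow> x^2 * w \<in> F" "x \<in> U" "z \<in> U"
  shows "x * (z * w) \<in> F"
proof (rule unscale[OF F separate_scalings(1)[OF F]])
  fix t :: z5
  have "x + scale5 t z \<in> U"
    using assms(2,3) U by (intro z5v.subspace_add z5v.subspace_scale)
  then have "(x + scale5 t z)^2 * w - x^2 * w \<in> F"
    using assms(1,2) by (intro z5v.subspace_diff[OF F])
  also have "(x + scale5 t z)^2 * w - x^2 * w = scale5 t (scale5 2 (x * (z * w)))
      + scale5 (t^2) (z^2 * w) + scale5 (t^3) 0 + scale5 (t^4) 0"
    by (simp add: fun_eq_iff scale5_def algebra_simps power2_eq_square)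
  finally show "\<dots> \<in> F" .
qed (rule z5_numerals_neq_0)

lemma polarize_3:
  assumes "\<And>x. x \<in> U \<Longrightarrow> x^3 * w \<in> F" "x \<in> U" "z \<in> U"
  shows "x^2 * (z * w) \<in> F"
proof (rule unscale[OF F separate_scalings(1)[OF F]])
  fix t :: z5
  have "x + scale5 t z \<in> U"
    using assms(2,3) U by (intro z5v.subspace_add z5v.subspace_scale)
  then have "(x + scale5 t z)^3 * w - x^3 * w \<in> F"
    using assms(1,2) by (intro z5v.subspace_diff[OF F])
  also have "(x + scale5 t z)^3 * w - x^3 * w = scale5 t (scale5 3 (x^2 * (z * w)))
      + scale5 (t^2) (scale5 3 (x * z^2 * w)) + scale5 (t^3) (z^3 * w) + scale5 (t^4) 0"
    by (simp add: fun_eq_iff scale5_def algebra_simps power2_eq_square power3_eq_cube)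
  finally show "\<dots> \<in> F" .
qed (rule z5_numerals_neq_0)

lemma polarize_4:
  assumes "\<And>x. x \<in> U \<Longrightarrow> x^4 * w \<in> F" "x \<in> U" "z \<in> U"
  shows "x^3 * (z * w) \<in> F"
proof (rule unscale[OF F separate_scalings(1)[OF F]])
  fix t :: z5
  have "x + scale5 t z \<in> U"
    using assms(2,3) U by (intro z5v.subspace_add z5v.subspace_scale)
  then have "(x + scale5 t z)^4 * w - x^4 * w \<in> F"
    using assms(1,2) by (intro z5v.subspace_diff[OF F])
  also have "(x + scale5 t z)^4 * w - x^4 * w = scale5 t (scale5 4 (x^3 * (z * w)))
      + scale5 (t^2) (scale5 6 (x^2 * z^2 * w)) + scale5 (t^3) (scale5 4 (x * z^3 * w))
      + scale5 (t^4) (z^4 * w)"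
    by (simp add: fun_eq_iff scale5_def algebra_simps power4_eq_xxxx power2_eq_square power3_eq_cube)
  finally show "\<dots> \<in> F" .
qed (rule z5_numerals_neq_0)

context
  assumes carry: "\<And>x y. x \<in> U \<Longrightarrow> y \<in> U \<Longrightarrow> vcarry x y \<in> F"
begin

text \<open>Scaling \<open>x\<close> splits the carry by degree in \<open>x\<close>. The part of
  degree 4 has a single term; those of degrees 2 and 3 are split further by scaling
  \<open>y\<close>, keeping the term linear in \<open>y\<close>.\<close>

lemma powers_in_carry_span:
  assumes "x \<in> U" "y \<in> U"
  shows "x^2 * y \<in> F" "x^3 * y \<in> F" "x^4 * y \<in> F"
proof -
  \<comment> \<open>The coefficients of \<open>s\<close>, \<open>s^2\<close> and \<open>s^3\<close>
    in the carry of \<open>scale5 s x\<close> and \<open>y\<close>.\<close>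
  let ?v1 = "\<lambda>y. scale5 4 (x*y^2) + scale5 3 (x*y^3) + scale5 4 (x*y^4)"
  let ?v2 = "\<lambda>y. scale5 4 (x^2*y) + scale5 2 (x^2*y^2) + scale5 3 (x^2*y^3)"
  let ?v3 = "\<lambda>y. scale5 3 (x^3*y) + scale5 3 (x^3*y^2)"
  have F1: "scale5 s (?v1 y) + scale5 (s^2) (?v2 y) + scale5 (s^3) (?v3 y)
      + scale5 (s^4) (scale5 4 (x^4*y)) \<in> F" if "y \<in> U" for s y
  proof -
    have "vcarry (scale5 s x) y \<in> F"
      using assms(1) that U by (intro carry z5v.subspace_scale)
    also have "vcarry (scale5 s x) y = scale5 s (?v1 y) + scale5 (s^2) (?v2 y) + scale5 (s^3) (?v3 y)
        + scale5 (s^4) (scale5 4 (x^4*y))"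
      by (simp add: vcarry_def fun_eq_iff carry_eq_polynomial scale5_def power_mult_distrib algebra_simps)
    finally show ?thesis .
  qed
  have v: "?v2 y \<in> F" "?v3 y \<in> F" "scale5 4 (x^4*y) \<in> F" if "y \<in> U" for y
    using separate_scalings(2,3,4)[OF F F1[OF that]] by auto
  show "x^4 * y \<in> F"
    using unscale[OF F v(3)[OF assms(2)] z5_numerals_neq_0(3)] .
  have ty: "scale5 t y \<in> U" for t
    using assms(2) U by (intro z5v.subspace_scale)
  have "scale5 t (scale5 3 (x^3*y)) + scale5 (t^2) (scale5 3 (x^3*y^2)) + scale5 (t^3) 0
      + scale5 (t^4) 0 \<in> F" for t
  proof -
    have "?v3 (scale5 t y) = scale5 t (scale5 3 (x^3*y)) + scale5 (t^2) (scale5 3 (x^3*y^2))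
        + scale5 (t^3) 0 + scale5 (t^4) 0"
      by (simp add: fun_eq_iff scale5_def power_mult_distrib algebra_simps)
    then show ?thesis using v(2)[OF ty, of t] by (simp only:)
  qed
  from unscale[OF F separate_scalings(1)[OF F this] z5_numerals_neq_0(2)] show "x^3 * y \<in> F" .
  have "scale5 t (scale5 4 (x^2*y)) + scale5 (t^2) (scale5 2 (x^2*y^2))
      + scale5 (t^3) (scale5 3 (x^2*y^3)) + scale5 (t^4) 0 \<in> F" for t
  proof -
    have "?v2 (scale5 t y) = scale5 t (scale5 4 (x^2*y)) + scale5 (t^2) (scale5 2 (x^2*y^2))
        + scale5 (t^3) (scale5 3 (x^2*y^3)) + scale5 (t^4) 0"
      by (simp add: fun_eq_iff scale5_def power_mult_distrib algebra_simps)
    then show ?thesis using v(1)[OF ty, of t] by (simp only:)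
  qed
  from unscale[OF F separate_scalings(1)[OF F this] z5_numerals_neq_0(3)] show "x^2 * y \<in> F" .
qed

text \<open>Each polarization replaces one copy of the repeated factor by a new one; starting from
  x^2 y, x^3 y and x^4 y, all factors become independent of each other.\<close>

lemma products_in_carry_span:
  assumes "x1 \<in> U" "x2 \<in> U" "x3 \<in> U"
  shows "x1 * (x2 * x3) \<in> F"
    "x4 \<in> U \<Longrightarrow> x1 * (x2 * (x3 * x4)) \<in> F"
    "x4 \<in> U \<Longrightarrow> x5 \<in> U \<Longrightarrow> x1 * (x2 * (x3 * (x4 * x5))) \<in> F"
proof -
  show "x1 * (x2 * x3) \<in> F"
    using powers_in_carry_span(1) assms by (intro polarize_2)
  show "x1 * (x2 * (x3 * x4)) \<in> F" if "x4 \<in> U"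
    using powers_in_carry_span(2) assms that by (intro polarize_2 polarize_3)
  show "x1 * (x2 * (x3 * (x4 * x5))) \<in> F" if "x4 \<in> U" "x5 \<in> U"
    using powers_in_carry_span(3) assms that by (intro polarize_2 polarize_3 polarize_4)
qed

lemma monomials_in_carry_span:
  assumes b: "\<And>i. i < k \<Longrightarrow> b i \<in> U" and e: "e \<in> nonlin k"
  shows "mon b e \<in> F"
proof -
  \<comment> \<open>Peeling off one variable per step displays a monomial of degree at most 5 as a
    product of that many variables.\<close>
  have mon_Suc: "\<exists>i<k. \<exists>e' \<in> exponents k d. mon b e = b i * mon b e'"
    if e: "e \<in> exponents k (Suc d)" for e d
  proof -
    obtain i where i: "i < k" "e ! i \<noteq> 0"
    proof -
      have "\<exists>a\<in>set e. a \<noteq> 0"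
        using e sum_list_eq_0_iff[of e] by (auto simp: exponents_def)
      then show thesis using that e by (auto simp: in_set_conv_nth exponents_def)
    qed
    let ?e = "e[i := e ! i - 1]"
    have len: "length e = k" using e by (simp add: exponents_def)
    have eq: "e = ?e[i := Suc (?e ! i)]"
      using i len by simp
    have "Suc (sum_list ?e) = Suc d"
      using sum_list_Suc_nth[of i ?e] eq i len e by (simp add: exponents_def)
    then have "?e \<in> exponents k d" using len by (simp add: exponents_def)
    moreover have "mon b e = b i * mon b ?e"
      using mult_mon[of i ?e b] eq i len by simp
    ultimately show ?thesis using i(1) by blast
  qed
  have mon_0: "mon b e = 1" if "e \<in> exponents k 0" for e
  proof -
    have "e ! i = 0" if "i < length e" for i
      using \<open>e \<in> exponents k 0\<close> nth_mem[OF that] by (simp add: exponents_def)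
    then show ?thesis by (simp add: mon_def)
  qed
  have mon_1: "\<exists>i<k. mon b e = b i" if "e \<in> exponents k (Suc 0)" for e
    using mon_Suc[OF that] mon_0 by (metis mult_1_right)
  have mon_2: "\<exists>i<k. \<exists>j<k. mon b e = b i * b j" if "e \<in> exponents k (Suc (Suc 0))" for e
    using mon_Suc[OF that] mon_1 by metis
  have mon_3: "\<exists>h<k. \<exists>i<k. \<exists>j<k. mon b e = b h * (b i * b j)"
    if "e \<in> exponents k (Suc (Suc (Suc 0)))" for e
    using mon_Suc[OF that] mon_2 by metis
  have mon_4: "\<exists>g<k. \<exists>h<k. \<exists>i<k. \<exists>j<k. mon b e = b g * (b h * (b i * b j))"
    if "e \<in> exponents k (Suc (Suc (Suc (Suc 0))))" for e
    using mon_Suc[OF that] mon_3 by metis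
  have mon_5: "\<exists>f<k. \<exists>g<k. \<exists>h<k. \<exists>i<k. \<exists>j<k. mon b e = b f * (b g * (b h * (b i * b j)))"
    if "e \<in> exponents k (Suc (Suc (Suc (Suc (Suc 0)))))" for e
    using mon_Suc[OF that] mon_4 by metis
  consider "e \<in> exponents k 3" | "e \<in> exponents k 4" | "e \<in> exponents k 5"
    using e by (auto simp: nonlin_def)
  then show ?thesis
  proof cases
    case 1
    then show ?thesis
      using mon_3[of e] b products_in_carry_span(1) by (auto simp: eval_nat_numeral)
  next
    case 2
    then show ?thesis
      using mon_4[of e] b products_in_carry_span(2) by (auto simp: eval_nat_numeral)
  next
    case 3
    then show ?thesis
      using mon_5[of e] b products_in_carry_span(3) by (auto simp: eval_nat_numeral)
  qed
qed

end

end

section \<open>Linear independence of monomials as functions on points\<close>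

text \<open>The points of \<open>\<int>\<^sub>5\<^sup>k\<close> are encoded by natural numbers through their base-5 digits.\<close>

definition dig :: "nat \<Rightarrow> nat \<Rightarrow> z5"
  where "dig i n = of_nat (n div 5 ^ i)"

lemma mon_dig_Cons: "mon dig (a # e) n = of_nat n ^ a * mon dig e (n div 5)"
  by (simp add: mon_def prod_fun_apply prod.lessThan_Suc_shift dig_def div_mult2_eq
      del: prod.lessThan_Suc)

text \<open>A nonzero polynomial of degree at most 4 cannot vanish at all five field
  elements.\<close>

lemma polynomial_function_coeffs_0:
  fixes q :: "nat \<Rightarrow> z5"
  assumes "\<And>t. (\<Sum>a<5. q a * t ^ a) = 0" "a < 5"
  shows "q a = 0"
proof -
  define p where "p = (\<Sum>a<5. monom (q a) a)"
  have coeff: "coeff p i = (if i < 5 then q i else 0)" for i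
    by (simp add: p_def coeff_sum sum.delta)
  have "degree p \<le> 4"
    by (rule degree_le) (simp add: coeff)
  moreover have "poly p t = 0" for t
    using assms(1) by (simp add: p_def poly_sum poly_monom)
  moreover have "card {x. poly p x = 0} \<le> degree p" if "p \<noteq> 0"
    using card_poly_roots_bound[OF that] .
  ultimately have "p = 0"
    using card_z5 by fastforce
  then show ?thesis using coeff[of a] assms(2) by simp
qed

text \<open>Exponent vectors reduced by the rule x^5 = x; distinct ones give different, even
  independent, functions.\<close>

definition reduced :: "nat \<Rightarrow> nat list set"
  where "reduced k = {e. set e \<subseteq> {..<5} \<and> length e = k}"

text \<open>Induction on the number of variables: with the higher digits fixed, the sum is a
  polynomial in the lowest digit whose coefficients are sums of the same kind in one variable
  less.\<close>

lemma mon_dig_coeffs_0: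
  assumes "\<And>n. (\<Sum>e\<in>reduced k. c e * mon dig e n) = 0" "e \<in> reduced k"
  shows "c e = 0"
  using assms
proof (induction k arbitrary: c e)
  case 0
  have "reduced 0 = {[]}" by (auto simp: reduced_def)
  then show ?case using 0 by (simp add: mon_def)
next
  case (Suc k)
  have red: "reduced (Suc k) = (\<lambda>(e, a). a # e) ` (reduced k \<times> {..<5})"
    unfolding reduced_def by (rule lists_length_Suc_eq)
  have inj: "inj_on (\<lambda>(e, a). a # e) (reduced k \<times> {..<5::nat})"
    by (auto simp: inj_on_def)
  have "(\<Sum>e\<in>reduced k. c (a # e) * mon dig e m) = 0" if "a < 5" for a m
  proof (rule polynomial_function_coeffs_0[OF _ that, where q = "\<lambda>a. \<Sum>e\<in>reduced k. c (a # e) * mon dig e m"])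
    fix t :: z5
    obtain t' where t': "t = of_int t'" "t' \<in> {0, 1, 2, 3, 4}"
      by (rule z5_cases)
    \<comment> \<open>The point with lowest digit \<open>t\<close> and the digits of
      \<open>m\<close> above it.\<close>
    define n where "n = 5 * m + nat t'"
    have n: "of_nat n = t" "n div 5 = m"
      using t' by (auto simp: n_def z5_numeral_5)
    have "0 = (\<Sum>e\<in>reduced (Suc k). c e * mon dig e n)"
      using Suc.prems(1) by simp
    also have "\<dots> = (\<Sum>(e, a)\<in>reduced k \<times> {..<5}. c (a # e) * mon dig (a # e) n)"
      unfolding red sum.reindex[OF inj] by (rule sum.cong) auto
    also have "\<dots> = (\<Sum>e\<in>reduced k. \<Sum>a<5. c (a # e) * mon dig (a # e) n)"
      by (simp add: sum.cartesian_product)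
    also have "\<dots> = (\<Sum>a<5. \<Sum>e\<in>reduced k. c (a # e) * mon dig (a # e) n)"
      by (rule sum.swap)
    also have "\<dots> = (\<Sum>a<5. (\<Sum>e\<in>reduced k. c (a # e) * mon dig e m) * t ^ a)"
      unfolding mon_dig_Cons n sum_distrib_right
      by (intro sum.cong refl) (simp only: mult.assoc mult.commute mult.left_commute)
    finally show "(\<Sum>a<5. (\<Sum>e\<in>reduced k. c (a # e) * mon dig e m) * t ^ a) = 0" ..
  qed
  moreover obtain a e' where "e = a # e'" "a < 5" "e' \<in> reduced k"
    using Suc.prems(2) unfolding red by auto
  ultimately show ?case
    using Suc.IH[of "\<lambda>e. c (a # e)" e'] by simp
qed

lemma finite_reduced: "finite (reduced k)"
  unfolding reduced_def by (rule finite_lists_length_eq) simp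

lemma inj_mon_dig: "inj_on (mon dig) (reduced k)"
proof (rule inj_onI)
  fix e e' assume e: "e \<in> reduced k" "e' \<in> reduced k" "mon dig e = mon dig e'"
  show "e = e'"
  proof (rule ccontr)
    assume ne: "e \<noteq> e'"
    let ?c = "\<lambda>f. (if f = e then 1 else 0) - (if f = e' then 1 else 0 :: z5)"
    have "(\<Sum>f\<in>reduced k. ?c f * mon dig f n) = 0" for n
    proof -
      have "(\<Sum>f\<in>reduced k. ?c f * mon dig f n) =
        (\<Sum>f\<in>reduced k. if f = e then mon dig f n else 0) - (\<Sum>f\<in>reduced k. if f = e' then mon dig f n else 0)"
        unfolding sum_subtractf[symmetric] by (rule sum.cong) auto
      also have "\<dots> = 0"
        using e by (simp add: finite_reduced)
      finally show ?thesis .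
    qed
    from mon_dig_coeffs_0[where k = k and c = ?c, OF this e(1)] show False
      using ne by simp
  qed
qed

lemma independent_mon_dig: "z5v.independent (mon dig ` reduced k)"
proof (rule z5v.independent_if_scalars_zero)
  show "finite (mon dig ` reduced k)"
    using finite_reduced by blast
  fix f x assume sum: "(\<Sum>x\<in>mon dig ` reduced k. scale5 (f x) x) = 0" and x: "x \<in> mon dig ` reduced k"
  obtain e where e: "x = mon dig e" "e \<in> reduced k"
    using x by blast
  have "(\<Sum>e\<in>reduced k. f (mon dig e) * mon dig e n) = 0" for n
    using fun_cong[OF sum, of n] unfolding sum.reindex[OF inj_mon_dig] o_def sum_fun_apply
    by (simp add: scale5_def)
  from mon_dig_coeffs_0[where k = k and c = "\<lambda>e. f (mon dig e)", OF this e(2)] show "f x = 0"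
    using e(1) by simp
qed

text \<open>The function space to be interpolated. Viewed as a function of the column of a generator
  matrix, a low digit is a linear form and a carry is a carry of two linear forms.\<close>

definition carry_space :: "nat \<Rightarrow> (nat \<Rightarrow> z5) set"
  where "carry_space k = z5v.span (dig ` {..<k} \<union>
    {vcarry x y |x y. x \<in> z5v.span (dig ` {..<k}) \<and> y \<in> z5v.span (dig ` {..<k})})"

lemma subspace_carry_space: "z5v.subspace (carry_space k)"
  by (simp add: carry_space_def)

lemma dig_in_carry_space: "i < k \<Longrightarrow> dig i \<in> carry_space k"
  unfolding carry_space_def by (intro z5v.span_base) auto

lemma vcarry_in_carry_space:
  "x \<in> z5v.span (dig ` {..<k}) \<Longrightarrow> y \<in> z5v.span (dig ` {..<k}) \<Longrightarrow> vcarry x y \<in> carry_space k"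
  unfolding carry_space_def by (intro z5v.span_base) auto

text \<open>The spanning monomials are the \<open>k\<close> variables and those in
  \<open>nonlin k\<close>: carries expand into them, and polarization recovers them from carries.
  All their exponents are below 5, so they are independent.\<close>

lemma dim_carry_space:
  "finite (carry_space k) \<and> z5v.dim (carry_space k) = k + card (nonlin k)"
proof -
  let ?lin = "(\<lambda>i. (replicate k (0::nat))[i := 1]) ` {..<k}"
  let ?E = "nonlin k \<union> ?lin"
  have lin_sum: "sum_list e = 1" if "e \<in> ?lin" for e
    using that by (auto simp: sum_list_update)
  have "nonlin k \<subseteq> reduced k"
  proof
    fix e assume e: "e \<in> nonlin k"
    have "a < 5" if "a \<in> set e" for a
      using that e member_le_sum_list[of a e]
      by (auto simp: nonlin_def exponents_def) (metis le_neq_implies_less)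
    then show "e \<in> reduced k"
      using e by (auto simp: reduced_def nonlin_def exponents_def)
  qed
  moreover have "?lin \<subseteq> reduced k"
    by (auto simp: reduced_def dest!: set_update_subset_insert[THEN subsetD])
  ultimately have E: "?E \<subseteq> reduced k" by blast
  have "inj_on (\<lambda>i. (replicate k (0::nat))[i := 1]) {..<k}"
  proof (rule inj_onI)
    fix i j assume "i \<in> {..<k}" "j \<in> {..<k}" "(replicate k (0::nat))[i := 1] = (replicate k 0)[j := 1]"
    then show "i = j"
      by (metis length_list_update length_replicate lessThan_iff nth_list_update nth_replicate zero_neq_one)
  qed
  then have "card ?lin = k"
    by (simp add: card_image)
  moreover have "nonlin k \<inter> ?lin = {}"
    using lin_sum by (force simp: nonlin_def exponents_def)
  ultimately have "card ?E = k + card (nonlin k)"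
    by (subst card_Un_disjoint) (auto simp: finite_nonlin)
  then have card: "card (mon dig ` ?E) = k + card (nonlin k)"
    using card_image[OF inj_on_subset[OF inj_mon_dig E]] by simp
  have fin: "finite (mon dig ` ?E)"
    using finite_nonlin by blast
  have indep: "z5v.independent (mon dig ` ?E)"
    using z5v.independent_mono[OF independent_mon_dig] E by blast
  have lin: "mon dig ` ?lin = dig ` {..<k}"
    by (auto simp: image_image mon_replicate_update)
  have "z5v.span (mon dig ` ?E) = carry_space k"
  proof (rule subset_antisym)
    have "mon dig e \<in> carry_space k" if "e \<in> nonlin k" for e
      using subspace_carry_space _ vcarry_in_carry_space _ that
    proof (rule monomials_in_carry_span)
      show "dig i \<in> z5v.span (dig ` {..<k})" if "i < k" for i
        using that by (intro z5v.span_base) auto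
    qed simp
    then show "z5v.span (mon dig ` ?E) \<subseteq> carry_space k"
      using dig_in_carry_space unfolding image_Un lin
      by (intro z5v.span_minimal subspace_carry_space) auto
    show "carry_space k \<subseteq> z5v.span (mon dig ` ?E)"
      unfolding carry_space_def image_Un lin using vcarry_in_span_nonlin
      by (intro z5v.span_minimal) (auto intro: z5v.span_base)
  qed
  then show ?thesis
    using finite_span_card[OF fin indep] z5v.dim_span_eq_card_independent[OF indep] card by simp
qed

section \<open>Interpolation at points of the finite space\<close>

definition interpolates :: "(nat \<Rightarrow> z5) set \<Rightarrow> nat set \<Rightarrow> bool"
  where "interpolates F S \<longleftrightarrow> (\<forall>g. \<exists>f\<in>F. \<forall>n\<in>S. f n = g n)"

lemma interpolates_insert:
  assumes "z5v.subspace F" "interpolates F S" "f \<in> F" "\<And>n. n \<in> S \<Longrightarrow> f n = 0" "f p \<noteq> 0"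
  shows "interpolates F (insert p S)"
  unfolding interpolates_def
proof
  fix g :: "nat \<Rightarrow> z5"
  obtain h where h: "h \<in> F" "\<And>n. n \<in> S \<Longrightarrow> h n = g n"
    using assms(2) unfolding interpolates_def by blast
  let ?c = "(g p - h p) / f p"
  have "h + scale5 ?c f \<in> F"
    using h(1) assms(1,3) by (intro z5v.subspace_add z5v.subspace_scale)
  moreover have "(h + scale5 ?c f) n = g n" if "n \<in> insert p S" for n
    using that h(2) assms(4,5) by (cases "n = p") (auto simp: scale5_def)
  ultimately show "\<exists>f\<in>F. \<forall>n\<in>insert p S. f n = g n" by blast
qed

text \<open>By counting, restriction to \<open>S\<close> cannot be injective on a space of larger
  dimension. A nonzero function vanishing on \<open>S\<close> is nonzero at some point, and that
  point is a new node.\<close>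

lemma interpolates_step:
  assumes F: "z5v.subspace F" "finite F" and S: "finite S" "interpolates F S" "card S < z5v.dim F"
  obtains p where "p \<notin> S" "interpolates F (insert p S)"
proof -
  have "\<exists>f\<in>F. f \<noteq> 0 \<and> (\<forall>n\<in>S. f n = 0)"
  proof (rule ccontr)
    assume contra: "\<not> (\<exists>f\<in>F. f \<noteq> 0 \<and> (\<forall>n\<in>S. f n = 0))"
    have "inj_on (\<lambda>f. restrict f S) F"
    proof (rule inj_onI)
      fix f g assume fg: "f \<in> F" "g \<in> F" "restrict f S = restrict g S"
      have "f - g \<in> F" using fg F(1) by (intro z5v.subspace_diff)
      moreover have "(f - g) n = 0" if "n \<in> S" for n
        using fun_cong[OF fg(3), of n] that by simp
      ultimately have "f - g = 0" using contra by blast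
      then show "f = g" by simp
    qed
    then have "card F \<le> card (PiE S (\<lambda>_. UNIV :: z5 set))"
      by (rule card_inj_on_le) (auto intro: finite_PiE S(1))
    also have "\<dots> = 5 ^ card S"
      using S(1) by (simp add: card_PiE card_five)
    finally have "(5::nat) ^ z5v.dim F \<le> 5 ^ card S"
      using card_subspace[OF F] by simp
    then show False using S(3) by simp
  qed
  then obtain f where f: "f \<in> F" "f \<noteq> 0" "\<forall>n\<in>S. f n = 0" by blast
  then obtain p where "f p \<noteq> 0" by (auto simp: fun_eq_iff)
  then show thesis
    using that[of p] interpolates_insert[OF F(1) S(2) f(1)] f(3) by blast
qed

lemma interpolates_extend:
  assumes F: "z5v.subspace F" "finite F" and S: "finite S" "interpolates F S"
    and r: "card S + r \<le> z5v.dim F"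
  shows "\<exists>T. S \<subseteq> T \<and> finite T \<and> card T = card S + r \<and> interpolates F T"
  using r
proof (induction r)
  case 0
  then show ?case using S by auto
next
  case (Suc r)
  then obtain T where T: "S \<subseteq> T" "finite T" "card T = card S + r" "interpolates F T"
    by auto
  have "card T < z5v.dim F" using T(3) Suc.prems by simp
  then obtain p where "p \<notin> T" "interpolates F (insert p T)"
    using interpolates_step[OF F T(2,4)] by blast
  then show ?case
    using T by (intro exI[of _ "insert p T"]) auto
qed

text \<open>The number \<open>5 ^ j\<close> encodes the unit vector in direction
  \<open>j\<close>.\<close>

lemma dig_power: "i < k \<Longrightarrow> j < k \<Longrightarrow> dig i (5 ^ j) = (if i = j then 1 else 0)"
proof -
  consider "i < j" | "i = j" | "j < i" by linarith
  then show ?thesis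
  proof cases
    case 1
    then obtain d where "j = i + Suc d" by (metis add_Suc_right less_iff_Suc_add)
    then have "(5::nat) ^ j div 5 ^ i = 5 * 5 ^ d" by (simp add: power_add)
    then show ?thesis using 1 by (simp add: dig_def z5_numeral_5)
  qed (simp_all add: dig_def)
qed

text \<open>Encodes the point (2, ..., 2), whose column later keeps the radical small, see
  \<open>radical_eq\<close>.\<close>

definition twos :: "nat \<Rightarrow> nat"
  where "twos k = (\<Sum>i<k. 2 * 5 ^ i)"

lemma dig_twos: "i < k \<Longrightarrow> dig i (twos k) = 2"
proof (induction i arbitrary: k)
  case 0
  then obtain k' where k: "k = Suc k'" by (cases k) auto
  have "twos k = 2 + 5 * twos k'"
    unfolding k twos_def by (simp add: sum.lessThan_Suc_shift sum_distrib_left del: sum.lessThan_Suc)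
  then show ?case by (simp add: dig_def z5_numeral_5)
next
  case (Suc i)
  then obtain k' where k: "k = Suc k'" by (cases k) auto
  have "twos k = 2 + 5 * twos k'"
    unfolding k twos_def by (simp add: sum.lessThan_Suc_shift sum_distrib_left del: sum.lessThan_Suc)
  then have "twos k div 5 = twos k'" by simp
  then have "dig (Suc i) (twos k) = dig i (twos k')"
    by (simp add: dig_def div_mult2_eq)
  then show ?case using Suc k by simp
qed

lemma points_exist:
  assumes "0 < k" "0 < r" "r \<le> card (nonlin k)"
  obtains p where "p 0 = twos k"
    "\<And>g h. \<exists>f\<in>carry_space k. (\<forall>i<k. f (5 ^ i) = g i) \<and> (\<forall>j<r. f (p j) = h j)"
proof -
  let ?F = "carry_space k" and ?S = "(\<lambda>i. 5 ^ i :: nat) ` {..<k}"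
  note F = subspace_carry_space[of k]
  have finF: "finite ?F" and dimF: "z5v.dim ?F = k + card (nonlin k)"
    using dim_carry_space by auto
  have inj5: "inj_on (\<lambda>i. 5 ^ i :: nat) A" for A
    by (auto simp: inj_on_def)
  have "interpolates ?F ?S"
    unfolding interpolates_def
  proof
    fix g :: "nat \<Rightarrow> z5"
    let ?f = "\<Sum>i<k. scale5 (g (5 ^ i)) (dig i)"
    have "?f \<in> ?F"
      using dig_in_carry_space F by (intro z5v.subspace_sum z5v.subspace_scale) auto
    moreover have "?f (5 ^ j) = g (5 ^ j)" if "j < k" for j
    proof -
      have "?f (5 ^ j) = (\<Sum>i<k. if i = j then g (5 ^ i) else 0)"
        unfolding sum_fun_apply by (rule sum.cong) (use that in \<open>auto simp: scale5_def dig_power[of _ k]\<close>)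
      then show ?thesis using that by simp
    qed
    ultimately show "\<exists>f\<in>?F. \<forall>n\<in>?S. f n = g n" by blast
  qed
  moreover
  have U: "z5v.span (dig ` {..<k}) \<subseteq> z5v.span (dig ` {..<k})" "dig 0 \<in> z5v.span (dig ` {..<k})"
    using assms(1) by (auto intro: z5v.span_base)
  \<comment> \<open>The polynomial x^3 - x in the first coordinate vanishes at 0 and 1, hence at all
    unit vectors, but equals 6 = 1 at 2. It adds (2, ..., 2) to the nodes.\<close>
  let ?f = "dig 0 ^ 2 * dig 0 - dig 0"
  have "dig 0 ^ 2 * dig 0 \<in> ?F"
    by (rule powers_in_carry_span(1)[OF F z5v.subspace_span vcarry_in_carry_space U(2) U(2)])
  then have "?f \<in> ?F"
    using dig_in_carry_space[OF assms(1)] by (intro z5v.subspace_diff[OF F])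
  moreover have f0: "?f n = 0" if "n \<in> ?S" for n
    using that assms(1) by (auto simp: dig_power[of 0 k] split: if_splits)
  moreover have fq: "?f (twos k) \<noteq> 0"
    using z5_of_int_eq_0_iff[of 6] by (simp add: dig_twos[OF assms(1)])
  ultimately have S: "interpolates ?F (insert (twos k) ?S)"
    using F by (intro interpolates_insert)
  have q: "twos k \<notin> ?S" using f0 fq by blast
  then have cardS: "card (insert (twos k) ?S) = Suc k"
    by (simp add: card_image[OF inj5])
  \<comment> \<open>Only \<open>r - 1\<close> further nodes are needed, since \<open>twos k\<close>
    is one of the \<open>r\<close> points.\<close>
  obtain T where T: "insert (twos k) ?S \<subseteq> T" "finite T" "card T = Suc k + (r - 1)" "interpolates ?F T"
    using interpolates_extend[OF F finF _ S, of "r - 1"] cardS dimF assms by auto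
  let ?T = "T - insert (twos k) ?S"
  have "card ?T = r - 1"
    using card_Diff_subset[OF _ T(1)] T(3) cardS by force
  then obtain p where p: "bij_betw p {0..<r - 1} ?T"
    using ex_bij_betw_nat_finite[of ?T] T(2) by auto
  let ?p = "\<lambda>j. if j = 0 then twos k else p (j - 1)"
  have p_mem: "?p j \<in> T - ?S" if "j < r" for j
    using that q T(1) bij_betwE[OF p] by auto
  have p_inj: "inj_on ?p {..<r}"
  proof (rule inj_onI)
    fix i j assume ij: "i \<in> {..<r}" "j \<in> {..<r}" "?p i = ?p j"
    have ne: "p (l - 1) \<noteq> twos k" if "l < r" "l \<noteq> 0" for l
      using that bij_betwE[OF p] by auto
    show "i = j"
    proof (cases "i = 0 \<or> j = 0")
      case True
      then show ?thesis
        using ij(3) ne[of i] ne[of j] ij(1,2) by (metis lessThan_iff)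
    next
      case False
      then have "i - 1 \<in> {0..<r - 1}" "j - 1 \<in> {0..<r - 1}" "p (i - 1) = p (j - 1)"
        using ij by auto
      then have "i - 1 = j - 1"
        using inj_onD[OF bij_betw_imp_inj_on[OF p]] by blast
      then show ?thesis using False by arith
    qed
  qed
  show thesis
  proof (rule that[of ?p])
    fix g h :: "nat \<Rightarrow> z5"
    let ?g = "\<lambda>n. if n \<in> ?S then g (inv_into {..<k} (\<lambda>i. 5 ^ i) n) else h (inv_into {..<r} ?p n)"
    have "\<exists>f\<in>?F. \<forall>n\<in>T. f n = ?g n"
      using T(4) unfolding interpolates_def by (rule spec)
    then obtain f where f: "f \<in> ?F" "\<And>n. n \<in> T \<Longrightarrow> f n = ?g n"
      by blast
    have "f (5 ^ i) = g i" if "i < k" for i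
      using f(2)[of "5 ^ i"] T(1) that inv_into_f_f[OF inj5, of i "{..<k}"] by auto
    moreover have "f (?p j) = h j" if "j < r" for j
      using f(2)[of "?p j"] p_mem[OF that] inv_into_f_f[OF p_inj, of j] that by simp
    ultimately show "\<exists>f\<in>?F. (\<forall>i<k. f (5 ^ i) = g i) \<and> (\<forall>j<r. f (?p j) = h j)"
      using f(1) by blast
  qed simp
qed

section \<open>Codes with prescribed kernel and rank\<close>

lemma dim_space5_vanishing:
  assumes "k \<le> n"
  shows "z5v.dim {v \<in> space5 n. \<forall>i<k. v i = 0} = n - k"
proof (rule dim_eqI)
  let ?S = "{v \<in> space5 n. \<forall>i<k. v i = 0}"
  show "z5v.subspace ?S"
    by (rule subspace_if_add_closed) (auto simp: space5_def)
  show "finite ?S"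
    by (rule finite_subset[OF _ conjunct1[OF finite_card_space5]]) auto
  have "bij_betw (\<lambda>v i. if i < k then 0 else v (i - k)) (space5 (n - k)) ?S"
    by (rule bij_betw_byWitness[where f' = "\<lambda>v i. v (i + k)"])
      (use assms in \<open>auto simp: space5_def\<close>)
  then show "card ?S = 5 ^ (n - k)"
    using finite_card_space5[of "n - k"] by (simp add: bij_betw_same_card)
qed

text \<open>Here \<open>k\<close> and \<open>r\<close> play the roles of \<open>kbar\<close> and
  \<open>rbar\<close>. The assumption \<open>fits\<close> provides room for \<delta> identity
  columns, \<open>r\<close> columns taken from the points \<open>p\<close>, and \<gamma> - \<kappa>
  columns for the remaining generators of order 5.\<close>

locale construction =
  fixes Y :: "nat \<Rightarrow> z5" and \<alpha> \<beta> \<gamma> \<delta> \<kappa> k r :: nat and p :: "nat \<Rightarrow> nat"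
  assumes Y: "Y 0 \<noteq> Y 1" and \<kappa>: "\<kappa> \<le> \<alpha>" "\<kappa> \<le> \<gamma>" and k: "k \<le> \<delta>"
    and fits: "\<delta> + r + (\<gamma> - \<kappa>) \<le> \<beta>"
    and twos: "0 < k \<Longrightarrow> 0 < r \<and> p 0 = twos k"
    and interp: "\<And>g h. \<exists>f\<in>carry_space k. (\<forall>i<k. f (5 ^ i) = g i) \<and> (\<forall>j<r. f (p j) = h j)"
begin

text \<open>The \<int>\<open>\<^sub>2\<^sub>5\<close>-columns of the generator matrix in three
  blocks, padded with zeros. The integer \<open>p (i - \<delta>) div 5 ^ j\<close> is congruent
  modulo 5 to digit \<open>j\<close> of the point.\<close>

definition psi_high :: "(nat \<Rightarrow> int) \<times> (nat \<Rightarrow> int) \<Rightarrow> nat \<Rightarrow> int"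
  where "psi_high c = (\<lambda>i. if i < \<delta> then snd c i
    else if i < \<delta> + r then (\<Sum>j<k. int (p (i - \<delta>) div 5 ^ j) * snd c j) mod 25
    else if i < \<delta> + r + (\<gamma> - \<kappa>) then 5 * fst c (\<kappa> + (i - \<delta> - r)) else 0)"

definition psi :: "(nat \<Rightarrow> int) \<times> (nat \<Rightarrow> int) \<Rightarrow> (nat \<Rightarrow> int) \<times> (nat \<Rightarrow> int)"
  where "psi c = ((\<lambda>i\<in>{..<\<alpha>}. if i < \<kappa> then fst c i else 0), (\<lambda>i\<in>{..<\<beta>}. psi_high c i))"

definition "A = psi ` carrier (mixed_group \<gamma> \<delta>)"

abbreviation "H \<equiv> mixed_group \<gamma> \<delta>"
abbreviation "G \<equiv> mixed_group \<alpha> \<beta>"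

lemma carrier_H:
  assumes "c \<in> carrier H"
  shows "i < \<gamma> \<Longrightarrow> 0 \<le> fst c i \<and> fst c i < 5" "i < \<delta> \<Longrightarrow> 0 \<le> snd c i \<and> snd c i < 25"
proof -
  have c: "fst c \<in> PiE {..<\<gamma>} (\<lambda>_. {0..<5})" "snd c \<in> PiE {..<\<delta>} (\<lambda>_. {0..<25})"
    using assms by (simp_all only: mixed_group_carrier mem_Times_iff)
  show "i < \<gamma> \<Longrightarrow> 0 \<le> fst c i \<and> fst c i < 5" "i < \<delta> \<Longrightarrow> 0 \<le> snd c i \<and> snd c i < 25"
    using PiE_mem[OF c(1), of i] PiE_mem[OF c(2), of i] by simp_all
qed

lemma psi_high_tail:
  assumes "\<kappa> \<le> i" "i < \<gamma>"
  shows "psi_high c (\<delta> + r + (i - \<kappa>)) = 5 * fst c i"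
proof -
  obtain d where "i = \<kappa> + d" using assms(1) le_Suc_ex by blast
  then show ?thesis using assms by (simp add: psi_high_def)
qed

lemma psi_high_mult:
  "psi_high (c \<otimes>\<^bsub>H\<^esub> d) i = (psi_high c i + psi_high d i) mod 25"
proof -
  consider "i < \<delta>" | "\<delta> \<le> i" "i < \<delta> + r" | "\<delta> + r \<le> i" "i < \<delta> + r + (\<gamma> - \<kappa>)"
    | "\<delta> + r + (\<gamma> - \<kappa>) \<le> i"
    by linarith
  then show ?thesis
  proof cases
    case 1
    then show ?thesis by (simp add: psi_high_def mixed_group_mult)
  next
    case 2
    let ?V = "\<lambda>j. int (p (i - \<delta>) div 5 ^ j)"
    have "(\<Sum>j<k. ?V j * snd (c \<otimes>\<^bsub>H\<^esub> d) j) mod 25 = (\<Sum>j<k. ?V j * ((snd c j + snd d j) mod 25)) mod 25"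
      using k by (intro arg_cong[where f = "\<lambda>x. x mod 25"] sum.cong) (auto simp: mixed_group_mult)
    also have "\<dots> = (\<Sum>j<k. (?V j * ((snd c j + snd d j) mod 25)) mod 25) mod 25"
      by (rule mod_sum_eq[symmetric])
    also have "\<dots> = (\<Sum>j<k. (?V j * (snd c j + snd d j)) mod 25) mod 25"
      by (simp only: mod_mult_right_eq)
    also have "\<dots> = (\<Sum>j<k. ?V j * (snd c j + snd d j)) mod 25"
      by (rule mod_sum_eq)
    also have "\<dots> = ((\<Sum>j<k. ?V j * snd c j) mod 25 + (\<Sum>j<k. ?V j * snd d j) mod 25) mod 25"
      unfolding distrib_left sum.distrib by (rule mod_add_eq[symmetric])
    moreover have "psi_high x i = (\<Sum>j<k. ?V j * snd x j) mod 25" for x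
      using 2 unfolding psi_high_def by simp
    ultimately show ?thesis by (simp only:)
  next
    case 3
    have "5 * ((a + b) mod 5) = (5 * a + 5 * b) mod 25" for a b :: int
      using mult_mod_right[of 5 "a + b" 5] by (simp add: distrib_left)
    then show ?thesis using 3 by (simp add: psi_high_def mixed_group_mult)
  next
    case 4
    then show ?thesis by (simp add: psi_high_def)
  qed
qed

lemma psi_hom: "psi \<in> hom H G"
proof (rule homI)
  fix c assume c: "c \<in> carrier H"
  have "0 \<le> psi_high c i \<and> psi_high c i < 25" if "i < \<beta>" for i
  proof -
    have "0 \<le> 5 * fst c (\<kappa> + (i - \<delta> - r)) \<and> 5 * fst c (\<kappa> + (i - \<delta> - r)) < 25"
      if "\<not> i < \<delta> + r" "i < \<delta> + r + (\<gamma> - \<kappa>)"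
      using carrier_H(1)[OF c, of "\<kappa> + (i - \<delta> - r)"] that by linarith
    then show ?thesis
      using carrier_H(2)[OF c, of i] by (simp add: psi_high_def)
  qed
  moreover have "0 \<le> fst c i \<and> fst c i < 5" if "i < \<kappa>" for i
    using carrier_H(1)[OF c, of i] that \<kappa> by simp
  ultimately show "psi c \<in> carrier G"
    by (auto simp: psi_def mixed_group_carrier)
next
  fix c d
  have "fst (psi (c \<otimes>\<^bsub>H\<^esub> d)) = fst (psi c \<otimes>\<^bsub>G\<^esub> psi d)"
    using \<kappa> by (auto simp: psi_def mixed_group_mult restrict_def)
  moreover have "snd (psi (c \<otimes>\<^bsub>H\<^esub> d)) = snd (psi c \<otimes>\<^bsub>G\<^esub> psi d)"
    unfolding mixed_group_mult[of \<alpha>] by (auto simp: psi_def psi_high_mult restrict_def)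
  ultimately show "psi (c \<otimes>\<^bsub>H\<^esub> d) = psi c \<otimes>\<^bsub>G\<^esub> psi d"
    by (rule prod_eqI)
qed

lemma psi_inj: "inj_on psi (carrier H)"
proof (rule inj_onI)
  fix c d assume c: "c \<in> carrier H" and d: "d \<in> carrier H" and eq: "psi c = psi d"
  have fst: "fst c \<in> PiE {..<\<gamma>} (\<lambda>_. {0..<5})" "fst d \<in> PiE {..<\<gamma>} (\<lambda>_. {0..<5})"
    and snd: "snd c \<in> PiE {..<\<delta>} (\<lambda>_. {0..<25})" "snd d \<in> PiE {..<\<delta>} (\<lambda>_. {0..<25})"
    using c d by (simp_all only: mixed_group_carrier mem_Times_iff)
  have low: "fst (psi c) i = fst (psi d) i" and high: "snd (psi c) i = snd (psi d) i" for i
    using eq by simp_all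
  have "fst c i = fst d i" if i: "i \<in> {..<\<gamma>}" for i
  proof (cases "i < \<kappa>")
    case True
    then show ?thesis using low[of i] \<kappa> by (simp add: psi_def)
  next
    case False
    then show ?thesis
      using high[of "\<delta> + r + (i - \<kappa>)"] psi_high_tail[of i] i fits
      by (simp add: psi_def del: diff_add_assoc diff_add_assoc2 split: if_splits)
  qed
  moreover have "snd c i = snd d i" if i: "i \<in> {..<\<delta>}" for i
    using high[of i] i fits by (simp add: psi_def psi_high_def)
  ultimately show "c = d"
    using PiE_ext[OF fst] PiE_ext[OF snd] by (simp add: prod_eq_iff)
qed

lemma group_hom_psi: "group_hom H G psi"
  by (simp add: group_hom_def group_hom_axioms_def group_mixed_group psi_hom)

lemma A_subgroup: "subgroup A G"
  unfolding A_def using group_hom.img_is_subgroup[OF group_hom_psi] .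

lemma A_iso: "G\<lparr>carrier := A\<rparr> \<cong> H"
proof -
  have "psi \<in> iso H (G\<lparr>carrier := A\<rparr>)"
    using psi_hom psi_inj by (auto simp: iso_def hom_def A_def bij_betw_def)
  then have "H \<cong> G\<lparr>carrier := A\<rparr>"
    by (auto simp: is_iso_def)
  then show ?thesis
    using group.iso_sym[OF group_mixed_group] by blast
qed

text \<open>With \<open>m = 1\<close> the vector \<open>w\<close> becomes the low digits of the
  \<int>\<open>\<^sub>2\<^sub>5\<close>-components, with \<open>m = 5\<close> their high
  digits.\<close>

definition lift :: "(nat \<Rightarrow> z5) \<Rightarrow> (nat \<Rightarrow> z5) \<Rightarrow> int \<Rightarrow> (nat \<Rightarrow> int) \<times> (nat \<Rightarrow> int)"
  where "lift u w m = ((\<lambda>i\<in>{..<\<gamma>}. to_int_mod_ring (u i)), (\<lambda>i\<in>{..<\<delta>}. m * to_int_mod_ring (w i)))"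

lemma lift_in_carrier:
  assumes "m \<in> {1, 5}"
  shows "lift u w m \<in> carrier H"
proof -
  have "to_int_mod_ring (x :: z5) \<ge> 0" "to_int_mod_ring (x :: z5) < 5" for x
    using z5_to_int_range[of x] by auto
  moreover have "5 * to_int_mod_ring (x :: z5) < 25" "to_int_mod_ring (x :: z5) < 25" for x
    using z5_to_int_range[of x] unfolding atLeastLessThan_iff by linarith+
  ultimately show ?thesis
    using assms by (auto simp: lift_def mixed_group_carrier)
qed

lemma A_type: "additive_code_of_type \<alpha> \<beta> \<gamma> \<delta> \<kappa> A"
proof -
  have "z5_part \<alpha> ` {c \<in> A. c [^]\<^bsub>G\<^esub> (5::nat) = \<one>\<^bsub>G\<^esub>} = space5 \<kappa>"
  proof (rule subset_antisym; rule subsetI)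
    fix x assume "x \<in> z5_part \<alpha> ` {c \<in> A. c [^]\<^bsub>G\<^esub> (5::nat) = \<one>\<^bsub>G\<^esub>}"
    then show "x \<in> space5 \<kappa>"
      by (auto simp: A_def psi_def z5_part_def space5_def)
  next
    fix x assume x: "x \<in> space5 \<kappa>"
    let ?c = "psi (lift x 0 1)"
    have "?c \<in> A"
      unfolding A_def by (rule imageI[OF lift_in_carrier]) simp
    moreover have "5 dvd snd ?c i" if "i < \<beta>" for i
    proof -
      have "(\<Sum>j<k. int (p (i - \<delta>) div 5 ^ j) * snd (lift x 0 1) j) = 0"
        using k by (intro sum.neutral) (auto simp: lift_def)
      then show ?thesis
        using that by (simp add: psi_def psi_high_def) (simp add: lift_def)
    qed
    moreover have "x = z5_part \<alpha> ?c"
      using x \<kappa> by (auto simp: z5_part_def psi_def lift_def space5_def fun_eq_iff)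
    ultimately show "x \<in> z5_part \<alpha> ` {c \<in> A. c [^]\<^bsub>G\<^esub> (5::nat) = \<one>\<^bsub>G\<^esub>}"
      unfolding mixed_group_pow_5_eq_one by blast
  qed
  then show ?thesis
    by (simp add: additive_code_of_type_def additive_code_def A_subgroup A_iso)
qed

section \<open>Digit subspaces of the constructed code\<close>

sublocale carry_code Y \<alpha> \<beta> "digits \<alpha> \<beta> ` A"
  by (rule carry_code_digits[OF _ Y]) (simp add: additive_code_def A_subgroup)

text \<open>The low digits of a codeword as a function of its \<delta> free ones. The last block
  contributes nothing, as its entries are multiples of 5.\<close>

definition extend :: "(nat \<Rightarrow> z5) \<Rightarrow> nat \<Rightarrow> z5"
  where "extend \<mu> = (\<lambda>i. if i < \<delta> then \<mu> i
    else if i < \<delta> + r then \<Sum>j<k. dig j (p (i - \<delta>)) * \<mu> j else 0)"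

lemma of_int_mod_25: "(of_int (a mod 25) :: z5) = of_int a"
  unfolding z5_of_int_eq_iff by (simp add: mod_mod_cancel)

lemma low_psi: "low \<beta> (psi c) = extend (\<lambda>i. of_int (snd c i))"
proof
  fix i
  show "low \<beta> (psi c) i = extend (\<lambda>i. of_int (snd c i)) i"
    using fits by (auto simp: low_def psi_def psi_high_def extend_def of_int_mod_25 dig_def z5_numeral_5)
qed

lemma lows_eq: "lows = range extend"
proof (rule subset_antisym; rule subsetI)
  fix l assume "l \<in> lows"
  then show "l \<in> range extend"
    unfolding lows_def by (auto simp: A_def digits_def low_psi)
next
  fix l assume "l \<in> range extend"
  then obtain \<mu> where l: "l = extend \<mu>" by blast
  have "low \<beta> (psi (lift 0 \<mu> 1)) = l"
    unfolding low_psi l extend_def fun_eq_iff using k by (auto simp: lift_def intro!: sum.cong)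
  moreover have "psi (lift 0 \<mu> 1) \<in> A"
    unfolding A_def by (rule imageI[OF lift_in_carrier]) simp
  ultimately show "l \<in> lows"
    unfolding lows_def by (force simp: digits_def)
qed

text \<open>The \<open>r\<close> middle columns involve only the first \<open>k\<close> components,
  so they vanish on multiples of 5 that are zero there. The other first-block digits and the last
  block can then be chosen freely.\<close>

lemma highsI:
  assumes "\<And>i. h i \<noteq> 0 \<Longrightarrow> i \<in> {k..<\<delta>} \<union> {\<delta> + r..<\<delta> + r + (\<gamma> - \<kappa>)}"
  shows "h \<in> highs"
proof -
  let ?u = "\<lambda>i. if i < \<kappa> then 0 else h (\<delta> + r + (i - \<kappa>))"
  let ?c = "lift ?u h 5"
  have snd_c: "snd ?c j = 5 * to_int_mod_ring (h j)" if "j < \<delta>" for j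
    using that by (simp add: lift_def)
  have h0: "h j = 0" if "j < k" for j
    using assms[of j] k that by force
  have sum0: "(\<Sum>j<k. int (p (i - \<delta>) div 5 ^ j) * snd ?c j) = 0" for i
    using k h0 by (intro sum.neutral) (auto simp: snd_c)
  have "z5_part \<alpha> (psi ?c) = 0"
    using \<kappa> by (auto simp: z5_part_def psi_def lift_def fun_eq_iff)
  moreover have "low \<beta> (psi ?c) = 0"
    unfolding low_eq_0_iff by (auto simp: psi_def psi_high_def sum0 snd_c)
  moreover have "high \<beta> (psi ?c) i = h i" for i
  proof -
    consider "i < \<delta>" | "\<delta> \<le> i" "i < \<delta> + r" | "\<delta> + r \<le> i" "i < \<delta> + r + (\<gamma> - \<kappa>)"
      | "\<delta> + r + (\<gamma> - \<kappa>) \<le> i"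
      by linarith
    then show ?thesis
    proof cases
      case 1
      then show ?thesis using fits by (simp add: high_def psi_def psi_high_def snd_c)
    next
      case 2
      then have "h i = 0" using assms[of i] by force
      then show ?thesis using 2 fits by (simp add: high_def psi_def psi_high_def sum0)
    next
      case 3
      then obtain d where "i = \<delta> + r + d" "d < \<gamma> - \<kappa>"
        by (metis add_less_cancel_left le_Suc_ex)
      moreover from this have "\<kappa> + d < \<gamma>" "\<delta> + r + d < \<delta> + r + \<gamma> - \<kappa>"
        using \<kappa> by linarith+
      ultimately show ?thesis using fits by (simp add: high_def psi_def psi_high_def) (simp add: lift_def)
    next
      case 4
      then have "h i = 0" using assms[of i] k by force
      then show ?thesis using 4 by (simp add: high_def psi_def psi_high_def)
    qed
  qed
  then have "high \<beta> (psi ?c) = h" by blast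
  moreover have "psi ?c \<in> A"
    unfolding A_def by (rule imageI[OF lift_in_carrier]) simp
  ultimately show ?thesis
    unfolding highs_def by (force simp: digits_def)
qed

text \<open>With zero low digits all components are multiples of 5. Multiplying them by a column
  causes no carry into the high digit, so the middle block is linear in the high digits.\<close>

lemma highsD:
  assumes "h \<in> highs" "\<delta> \<le> i" "i < \<delta> + r"
  shows "h i = (\<Sum>j<k. dig j (p (i - \<delta>)) * h j)"
proof -
  obtain c where c: "low \<beta> (psi c) = 0" "high \<beta> (psi c) = h"
    using assms(1) unfolding highs_def by (auto simp: A_def digits_def)
  have "\<exists>w. snd c j = 5 * w" if "j < \<delta>" for j
  proof -
    have "5 dvd snd (psi c) j"
      using c(1) that fits by (simp add: low_eq_0_iff)
    then show ?thesis
      using that fits by (auto simp: psi_def psi_high_def elim: dvdE)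
  qed
  then obtain w where w: "\<And>j. j < \<delta> \<Longrightarrow> snd c j = 5 * w j"
    by metis
  have h: "h j = of_int (w j)" if "j < \<delta>" for j
    unfolding c(2)[symmetric] using that fits w by (simp add: high_def psi_def psi_high_def)
  have "(\<Sum>j<k. int (p (i - \<delta>) div 5 ^ j) * snd c j) = 5 * (\<Sum>j<k. int (p (i - \<delta>) div 5 ^ j) * w j)"
    unfolding sum_distrib_left using w k by (intro sum.cong) auto
  then have "(\<Sum>j<k. int (p (i - \<delta>) div 5 ^ j) * snd c j) mod 25 =
      5 * ((\<Sum>j<k. int (p (i - \<delta>) div 5 ^ j) * w j) mod 5)"
    using mult_mod_right[of 5 "\<Sum>j<k. int (p (i - \<delta>) div 5 ^ j) * w j" 5] by simp
  then have "h i = of_int (\<Sum>j<k. int (p (i - \<delta>) div 5 ^ j) * w j)"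
    unfolding c(2)[symmetric] using assms(2,3) fits by (simp add: high_def psi_def psi_high_def)
  also have "\<dots> = (\<Sum>j<k. dig j (p (i - \<delta>)) * h j)"
    unfolding of_int_sum using h k by (intro sum.cong) (auto simp: dig_def)
  finally show ?thesis .
qed

lemma radical_eq: "radical = {v \<in> space5 \<delta>. \<forall>i<k. v i = 0}"
proof (rule subset_antisym; rule subsetI)
  fix m assume m: "m \<in> radical"
  then obtain \<mu> where \<mu>: "m = extend \<mu>"
    by (auto simp: radical_def lows_eq)
  have m0: "m i = 0" if i: "i < k" for i
  proof (rule carry_all_0_imp_0)
    fix s :: z5
    \<comment> \<open>The test word has free low digits zero except for \<open>s\<close> at position
      \<open>i\<close>, so among the first \<open>k\<close> positions its carry with
      \<open>m\<close> lives at \<open>i\<close> only.\<close>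
    let ?e = "\<lambda>j. if j = i then s else 0"
    have r: "0 < r" "p 0 = twos k" using twos i by auto
    let ?h = "vcarry m (extend ?e)"
    have "?h \<in> highs"
      using m by (auto simp: radical_def lows_eq)
    \<comment> \<open>At position \<delta> the column is (2, ..., 2), so membership in P forces one
      carry to be twice another.\<close>
    then have "?h \<delta> = (\<Sum>j<k. dig j (p (\<delta> - \<delta>)) * ?h j)"
      using r by (intro highsD) auto
    also have "\<dots> = (\<Sum>j<k. if j = i then 2 * carry (m i) s else 0)"
      using k by (intro sum.cong) (auto simp: r(2) dig_twos vcarry_def extend_def)
    also have "\<dots> = 2 * carry (m i) s"
      using i by simp
    finally have "carry (m \<delta>) (extend ?e \<delta>) = 2 * carry (m i) s"
      by (simp add: vcarry_def)
    then show "carry (m i) s = 0"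
      by (rule carry_eq_double_carry_imp_0)
  qed
  moreover have "m i = 0" if "\<delta> \<le> i" for i
  proof -
    have "\<mu> j = 0" if "j < k" for j
      using m0[OF that] that k by (simp add: \<mu> extend_def)
    then show ?thesis
      using that by (simp add: \<mu> extend_def)
  qed
  ultimately show "m \<in> {v \<in> space5 \<delta>. \<forall>i<k. v i = 0}"
    by (simp add: space5_def)
next
  fix m assume "m \<in> {v \<in> space5 \<delta>. \<forall>i<k. v i = 0}"
  then have m: "\<And>i. \<delta> \<le> i \<Longrightarrow> m i = 0" "\<And>i. i < k \<Longrightarrow> m i = 0"
    by (auto simp: space5_def)
  have "m = extend m"
    by (auto simp: extend_def m fun_eq_iff)
  then have "m \<in> lows" unfolding lows_eq by blast
  moreover have "vcarry m l \<in> highs" for l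
  proof (rule highsI)
    fix i assume "vcarry m l i \<noteq> 0"
    then have "m i \<noteq> 0" by (auto simp: vcarry_def)
    then have "k \<le> i" "i < \<delta>"
      using m[of i] by (meson not_le)+
    then show "i \<in> {k..<\<delta>} \<union> {\<delta> + r..<\<delta> + r + (\<gamma> - \<kappa>)}"
      by simp
  qed
  ultimately show "m \<in> radical" by (simp add: radical_def)
qed

text \<open>Evaluation at the nodes, placed at the coordinates whose columns they are. It commutes
  with addition and carries and sends the variables to low digits of codewords, which puts the image
  of \<open>carry_space k\<close> into \<open>envelope\<close>.\<close>

definition sample :: "(nat \<Rightarrow> z5) \<Rightarrow> nat \<Rightarrow> z5"
  where "sample f = (\<lambda>i. if i < k then f (5 ^ i)
    else if \<delta> \<le> i \<and> i < \<delta> + r then f (p (i - \<delta>)) else 0)"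

lemma sample_in_envelope:
  assumes "f \<in> carry_space k"
  shows "sample f \<in> envelope"
proof -
  have add: "sample (x + y) = sample x + sample y" for x y
    by (simp add: sample_def fun_eq_iff)
  have sub: "z5v.subspace {f. sample f \<in> S}" if "z5v.subspace S" for S
  proof (rule subspace_if_add_closed)
    have "sample 0 = 0" by (simp add: sample_def fun_eq_iff)
    then show "0 \<in> {f. sample f \<in> S}"
      using z5v.subspace_0[OF that] by simp
    show "x + y \<in> {f. sample f \<in> S}" if "x \<in> {f. sample f \<in> S}" "y \<in> {f. sample f \<in> S}" for x y
      using that z5v.subspace_add[OF \<open>z5v.subspace S\<close>] by (simp only: mem_Collect_eq add)
  qed
  have dig: "sample (dig j) \<in> lows" if j: "j < k" for j
  proof -
    have "sample (dig j) i = extend (\<lambda>i. if i = j then 1 else 0) i" for i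
    proof -
      have "(\<Sum>j'<k. dig j' (p (i - \<delta>)) * (if j' = j then 1 else 0)) =
          (\<Sum>j'<k. if j' = j then dig j' (p (i - \<delta>)) else 0)"
        by (rule sum.cong) auto
      also have "\<dots> = dig j (p (i - \<delta>))"
        using j by simp
      finally show ?thesis
        using j k by (auto simp: sample_def extend_def dig_power[of j k])
    qed
    then show ?thesis unfolding lows_eq by blast
  qed
  then have lin: "z5v.span (dig ` {..<k}) \<subseteq> {f. sample f \<in> lows}"
    by (intro z5v.span_minimal sub subspace_lows) auto
  have vcarry: "sample (vcarry x y) = vcarry (sample x) (sample y)" for x y
    by (simp add: sample_def vcarry_def fun_eq_iff)
  have "lows \<subseteq> envelope"
    using lows_subset_highs highs_subset_envelope by blast
  then have "carry_space k \<subseteq> {f. sample f \<in> envelope}"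
    unfolding carry_space_def using lin dig
    by (intro z5v.span_minimal sub subspace_envelope)
      (auto simp only: vcarry intro!: vcarry_in_envelope dest: z5v.span_base)
  then show ?thesis using assms by blast
qed

text \<open>Interpolation matches a given vector on the first \<open>k\<close> coordinates and on
  the middle block. The difference is supported where \<open>highsI\<close> applies.\<close>

lemma envelope_eq: "envelope = space5 (\<delta> + r + (\<gamma> - \<kappa>))"
proof (rule subset_antisym)
  have lows: "lows \<subseteq> space5 (\<delta> + r + (\<gamma> - \<kappa>))"
    by (auto simp: lows_eq extend_def space5_def)
  moreover have "highs \<subseteq> space5 (\<delta> + r + (\<gamma> - \<kappa>))"
    unfolding highs_def by (auto simp: digits_def A_def high_def psi_def psi_high_def space5_def)
  ultimately show "envelope \<subseteq> space5 (\<delta> + r + (\<gamma> - \<kappa>))"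
    unfolding envelope_def using vcarry_in_space5
    by (intro z5v.span_minimal subspace_space5) (auto simp: carries_def)
  show "space5 (\<delta> + r + (\<gamma> - \<kappa>)) \<subseteq> envelope"
  proof
    fix v assume v: "v \<in> space5 (\<delta> + r + (\<gamma> - \<kappa>))"
    obtain f where f: "f \<in> carry_space k" "\<And>i. i < k \<Longrightarrow> f (5 ^ i) = v i"
        "\<And>j. j < r \<Longrightarrow> f (p j) = v (\<delta> + j)"
      using interp[of v "\<lambda>j. v (\<delta> + j)"] by blast
    have val: "sample f i = (if i < k \<or> \<delta> \<le> i \<and> i < \<delta> + r then v i else 0)" for i
      using f(2)[of i] f(3)[of "i - \<delta>"] by (auto simp: sample_def)
    have "v - sample f \<in> highs"
    proof (intro highsI)
      fix i assume i: "(v - sample f) i \<noteq> 0"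
      then have "v i \<noteq> 0"
        using val[of i] by (auto split: if_splits)
      then have "i < \<delta> + r + (\<gamma> - \<kappa>)"
        using v by (auto simp: space5_def not_le[symmetric] simp del: not_le)
      then show "i \<in> {k..<\<delta>} \<union> {\<delta> + r..<\<delta> + r + (\<gamma> - \<kappa>)}"
        using i val[of i] by (auto split: if_splits)
    qed
    then have "(v - sample f) + sample f \<in> envelope"
      using highs_subset_envelope sample_in_envelope[OF f(1)] by (intro z5v.subspace_add[OF subspace_envelope]) auto
    then show "v \<in> envelope" by (simp only: diff_add_cancel)
  qed
qed

lemma exists_code:
  "\<exists>C. linear_code_of_type Y \<alpha> \<beta> \<gamma> \<delta> \<kappa> C \<and>
    int (code_ker (\<alpha> + 5 * \<beta>) C) = int \<gamma> + 2 * int \<delta> - int k \<and>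
    int (code_rank C) = int \<gamma> + 2 * int \<delta> + int r"
proof -
  note par = digits_parameters[OF A_type Y]
  note dims = parameters[OF par(2-4)]
  have "z5v.dim radical = \<delta> - k"
    unfolding radical_eq using dim_space5_vanishing[OF k] .
  moreover have "z5v.dim envelope = \<delta> + r + (\<gamma> - \<kappa>)"
    unfolding envelope_eq by simp
  ultimately have "int (code_ker (\<alpha> + 5 * \<beta>) code) = int \<gamma> + 2 * int \<delta> - int k"
      "int (code_rank code) = int \<gamma> + 2 * int \<delta> + int r"
    using dims k \<kappa> by linarith+
  then show ?thesis
    unfolding par(1) using A_type by (auto simp: linear_code_of_type_def)
qed

end

section \<open>Necessary conditions and the equivalence\<close>

lemma type_bounds:
  assumes type: "linear_code_of_type Y \<alpha> \<beta> \<gamma> \<delta> \<kappa> C" and Y: "Y 0 \<noteq> Y 1"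
    and ker: "int (code_ker (\<alpha> + 5 * \<beta>) C) = int \<gamma> + 2 * int \<delta> - kbar"
    and rank: "int (code_rank C) = int \<gamma> + 2 * int \<delta> + rbar"
  shows "0 \<le> kbar" "kbar \<le> int \<delta>" "0 \<le> rbar" "rbar \<le> int \<beta> - (int \<gamma> - int \<kappa>) - int \<delta>"
    "rbar \<le> int (card (nonlin (nat kbar)))" "kbar = 0 \<longleftrightarrow> rbar = 0"
proof -
  obtain A where A: "additive_code_of_type \<alpha> \<beta> \<gamma> \<delta> \<kappa> A" "C = Gray Y \<alpha> \<beta> ` A"
    using type by (auto simp: linear_code_of_type_def)
  interpret carry_code Y \<alpha> \<beta> "digits \<alpha> \<beta> ` A"
    using A(1) Y by (intro carry_code_digits) (auto simp: additive_code_of_type_def)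
  note par = digits_parameters[OF A(1) Y]
  note dims = parameters[OF par(2-4)]
  have C: "C = code" using A(2) par(1) by simp
  have kbar: "kbar = int \<delta> - int (z5v.dim radical)"
    using ker dims(3) unfolding C by linarith
  have rbar: "rbar = int (z5v.dim envelope) - int (z5v.dim highs)"
    using rank dims(4) unfolding C by linarith
  show "0 \<le> kbar" "kbar \<le> int \<delta>"
    using kbar dim_radical_le dims(1) by linarith+
  show "0 \<le> rbar"
    using rbar dim_highs_le by linarith
  show "rbar \<le> int \<beta> - (int \<gamma> - int \<kappa>) - int \<delta>"
    using rbar dim_envelope_le dims(2) by linarith
  have "nat kbar = z5v.dim lows - z5v.dim radical"
    using kbar dims(1) by simp
  then show "rbar \<le> int (card (nonlin (nat kbar)))"
    using rbar dim_envelope_le_nonlin by simp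
  show "kbar = 0 \<longleftrightarrow> rbar = 0"
    using kbar rbar trivial_iff dims(1) by auto
qed

theorem theorem9:
  fixes \<alpha> \<beta> \<gamma> \<delta> \<kappa> :: nat and kbar rbar :: int and Y :: "nat \<Rightarrow> z5"
  assumes "bij_betw Y {..<5} UNIV"
    and "0 < \<alpha>" "0 < \<beta>" "0 < \<gamma>" "0 < \<delta>" "0 < \<kappa>"
    and "0 < \<delta> + \<gamma>" "\<delta> + \<gamma> \<le> \<beta> + \<kappa>"
    and "\<kappa> \<le> min \<alpha> \<gamma>"
  shows "(\<exists>C. linear_code_of_type Y \<alpha> \<beta> \<gamma> \<delta> \<kappa> C \<and>
            int (code_ker (\<alpha> + 5 * \<beta>) C) = int \<gamma> + 2 * int \<delta> - kbar \<and>
            int (code_rank C) = int \<gamma> + 2 * int \<delta> + rbar)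
     \<longleftrightarrow> (kbar \<in> {1..int \<delta>} \<and>
          rbar \<in> {1..min (int \<beta> - (int \<gamma> - int \<kappa>) - int \<delta>)
                     (int ((nat kbar + 2) choose 3) + int ((nat kbar + 3) choose 4)
                       + int ((nat kbar + 4) choose 5) - kbar)})
       \<or> (kbar = 0 \<and> rbar = 0)"
proof -
  have "inj_on Y {..<5}"
    using assms(1) by (simp add: bij_betw_def)
  then have Y: "Y 0 \<noteq> Y 1"
    using inj_onD[of Y "{..<5}" 0 1] by auto
  have nonlin: "int ((nat kbar + 2) choose 3) + int ((nat kbar + 3) choose 4)
      + int ((nat kbar + 4) choose 5) - kbar = int (card (nonlin (nat kbar)))" if "0 \<le> kbar"
    using card_nonlin[of "nat kbar"] that by linarith
  show ?thesis (is "?L \<longleftrightarrow> ?R")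
  proof
    assume ?L
    then obtain C where C: "linear_code_of_type Y \<alpha> \<beta> \<gamma> \<delta> \<kappa> C"
      "int (code_ker (\<alpha> + 5 * \<beta>) C) = int \<gamma> + 2 * int \<delta> - kbar"
      "int (code_rank C) = int \<gamma> + 2 * int \<delta> + rbar"
      by blast
    note bounds = type_bounds[OF C(1) Y C(2,3)]
    show ?R
    proof (cases "kbar = 0")
      case True
      then show ?thesis using bounds by simp
    next
      case False
      then have "1 \<le> kbar" "1 \<le> rbar" using bounds by linarith+
      then show ?thesis using bounds nonlin by simp
    qed
  next
    assume R: ?R
    define k where "k = nat kbar"
    define r where "r = nat rbar"
    \<comment> \<open>When both parameters are zero, the room for the columns comes from \<delta> +
      \<gamma> \<le> \<beta> + \<kappa>; the truncated difference \<gamma> - \<kappa> is exact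
      because \<kappa> \<le> \<gamma>.\<close>
    have kr: "kbar = int k" "rbar = int r" "k \<le> \<delta>" "\<delta> + r + (\<gamma> - \<kappa>) \<le> \<beta>"
      using R assms(8,9) by (auto simp: k_def r_def)
    obtain p where p: "0 < k \<Longrightarrow> 0 < r \<and> p 0 = twos k"
      "\<And>g h. \<exists>f\<in>carry_space k. (\<forall>i<k. f (5 ^ i) = g i) \<and> (\<forall>j<r. f (p j) = h j)"
    proof (cases "k = 0")
      case True
      \<comment> \<open>There are no nodes in this case, so the zero function satisfies every
        interpolation condition and the choice of \<open>p\<close> is arbitrary.\<close>
      then have "r = 0" using R kr by auto
      then show thesis
        using that[of "\<lambda>_. 0"] True z5v.subspace_0[OF subspace_carry_space] by auto
    next
      case False
      then have "0 < k" "0 < r" "r \<le> card (nonlin k)"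
        using R kr nonlin by auto
      then show thesis
        using points_exist[of k r] that by metis
    qed
    interpret construction Y \<alpha> \<beta> \<gamma> \<delta> \<kappa> k r p
      by unfold_locales (use Y assms(9) kr p in auto)
    show ?L
      using exists_code unfolding kr(1,2) .
  qed
qed

end
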